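(* Let $\kappa>0$ and let $(X,d)$ be a locally compact, uniquely geodesic $\mathrm{CAT}(\kappa)$ space such that for every $p\in X$ the space $X$ has the geodesic extension property around $p$ with a constant $R_p<\frac{\pi}{2\sqrt{\kappa}}$. Let $f:X\to(-\infty,\infty]$ be convex, let $x\in\operatorname{dom} f$, and let $([\gamma],r)\in T_xX$. For $y\in X$, denote by $\gamma^y$ the geodesic from $x$ to $y$. Then $([\gamma],r)\in\partial f(x)$ if and only if $$\langle([\gamma],r),([\gamma^y],d(x,y))\rangle+f(x)\le f(y)\quad\text{for all }y\in X.$$
   Context: Geodesics. A geodesic is an isometric map $\gamma:[0,l]\to X$; it issues at $\gamma(0)$. $X$ is uniquely geodesic if every two points are joined by a unique geodesic segment. $C\subseteq X$ is convex if it contains every geodesic segment joining two of its points. $X$ has the geodesic extension property around $p\in X$ with constant $R>0$ if for any distinct $y,z\in B(p,R)$ with $d(y,z)<R$, the geodesic from $y$ to $z$ can be extended beyond $z$ to a geodesic of length $R$. A $\mathrm{CAT}(\kappa)$ space ($\kappa>0$) is a metric space in which points at distance less than $\pi/\sqrt\kappa$ are joined by a geodesic and geodesic triangles of perimeter less than $2\pi/\sqrt\kappa$ are not thicker than their comparison triangles in the simply connected surface of constant curvature $\kappa$. Tangent space. For $x\in X$, $\Sigma_xX$ is the set of equivalence classes $[\gamma]$ of nonconstant geodesics issuing at $x$, where $\gamma\sim\eta$ iff the Alexandrov angle $\angle(\gamma,\eta)$ is $0$. By geodesic extension, a representative may always be taken of length at least $R_x$. The tangent space $T_xX$ is the Euclidean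 cone over $(\Sigma_xX,\angle)$: its elements are pairs $([\gamma],r)$ with $[\gamma]\in\Sigma_xX$, $r\ge0$, all pairs with $r=0$ being identified to one point $o_x$, the origin (for $o_x$ the geodesic may also be taken constantly equal to $x$; in particular $([\gamma^x],d(x,x))=o_x$). The scalar product is $\langle([\gamma],r),([\eta],s)\rangle=rs\cos\angle(\gamma,\eta)$, equal to $0$ if $r=0$ or $s=0$. Normal cone. For a uniquely geodesic space $Y$ of this kind, $C\subseteq Y$ nonempty convex and $y\in C$, let $P_C(z)=\{c\in C: d(z,c)=\operatorname{dist}(z,C)\}$ and $N_C(y)=\{([\gamma],r)\in T_yY : r=0 \text{ or } P_C(\gamma(t))=\{y\}\text{ for some }t>0\}$. Functions. $f:X\to(-\infty,\infty]$ is convex if $f(\gamma(lt))\le(1-t)f(\gamma(0))+tf(\gamma(l))$ for every geodesic $\gamma:[0,l]\to X$ and $t\in[0,1]$; $\operatorname{dom} f=\{f<\infty\}$; $\operatorname{epi} f=\{(x,\lambda)\in\operatorname{dom} f\times\mathbb{R}:\lambda\ge f(x)\}$. Subdifferential. $X\times\mathbb{R}$ carries the metric $d_2((x_1,y_1),(x_2,y_2))=\sqrt{d(x_1,x_2)^2+|y_1-y_2|^2}$. For $f$ convex and $x\in\operatorname{dom} f$, $([\gamma],r)\in T_xX$ is a subgradient of $f$ at $x$ if $([\sigma],1)\in N_{\operatorname{epi} f}(x,f(x))$ (normal cone in $X\times\mathbb{R}$), where $\sigma:[0,R_x]\to X\times\mathbb{R}$, $\sigma(t)=\left(\gamma\left(rt/\sqrt{r^2+1}\right),\,f(x)-t/\sqrt{r^2+1}\right)$.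 The set of subgradients is $\partial f(x)$. *)

theory Defs
  imports "HOL-Analysis.Analysis"
begin

section \<open>Geodesics\<close>

text \<open>The distance function \<open>d\<close> and the carrier \<open>M\<close> are parameters, so that the same notions
  serve a metric space given as a type and the model sphere below. A map \<open>[0,l] \<rightarrow> M\<close> is
  encoded by a function on \<open>real\<close> together with \<open>l\<close>; values outside \<open>[0,l]\<close> are irrelevant.\<close>

definition geodesic_wrt :: "('b \<Rightarrow> 'b \<Rightarrow> real) \<Rightarrow> 'b set \<Rightarrow> (real \<Rightarrow> 'b) \<Rightarrow> real \<Rightarrow> bool" where
  "geodesic_wrt d M g l \<longleftrightarrow>
     0 \<le> l \<and> g ` {0..l} \<subseteq> M \<and> (\<forall>s\<in>{0..l}. \<forall>t\<in>{0..l}. d (g s) (g t) = \<bar>s - t\<bar>)"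

definition joins_wrt :: "('b \<Rightarrow> 'b \<Rightarrow> real) \<Rightarrow> 'b set \<Rightarrow> (real \<Rightarrow> 'b) \<Rightarrow> 'b \<Rightarrow> 'b \<Rightarrow> bool" where
  "joins_wrt d M g p q \<longleftrightarrow> geodesic_wrt d M g (d p q) \<and> g 0 = p \<and> g (d p q) = q"

abbreviation geodesic :: "(real \<Rightarrow> 'a::metric_space) \<Rightarrow> real \<Rightarrow> bool" where
  "geodesic \<equiv> geodesic_wrt dist UNIV"

abbreviation joins :: "(real \<Rightarrow> 'a::metric_space) \<Rightarrow> 'a \<Rightarrow> 'a \<Rightarrow> bool" where
  "joins \<equiv> joins_wrt dist UNIV"

definition geodesic_segment :: "'a::metric_space \<Rightarrow> 'a \<Rightarrow> 'a set \<Rightarrow> bool" where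
  "geodesic_segment p q S \<longleftrightarrow> (\<exists>g. joins g p q \<and> S = g ` {0..dist p q})"

definition uniquely_geodesic :: "'a::metric_space itself \<Rightarrow> bool" where
  "uniquely_geodesic _ \<longleftrightarrow> (\<forall>p q :: 'a. \<exists>!S. geodesic_segment p q S)"

definition geodesic_extension_around :: "'a::metric_space \<Rightarrow> real \<Rightarrow> bool" where
  "geodesic_extension_around p R \<longleftrightarrow> 0 < R \<and>
     (\<forall>y\<in>ball p R. \<forall>z\<in>ball p R. y \<noteq> z \<and> dist y z < R \<longrightarrow>
        (\<forall>g. joins g y z \<longrightarrow> (\<exists>h. geodesic h R \<and> (\<forall>t\<in>{0..dist y z}. h t = g t))))"

text \<open>In a uniquely geodesic space, the chosen map is determined on \<open>[0, dist x y]\<close>.\<close>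

definition geodesic_to :: "'a::metric_space \<Rightarrow> 'a \<Rightarrow> (real \<Rightarrow> 'a)" where
  "geodesic_to x y = (SOME g. joins g x y)"

section \<open>CAT(\<open>\<kappa>\<close>) spaces, \<open>\<kappa> > 0\<close>\<close>

text \<open>The simply connected surface of constant curvature \<open>\<kappa> > 0\<close>: the unit sphere in
  three-dimensional Euclidean space with its angular metric divided by \<open>sqrt \<kappa>\<close>.\<close>

definition model_sphere :: "(real^3) set" where
  "model_sphere = sphere 0 1"

definition model_dist :: "real \<Rightarrow> real^3 \<Rightarrow> real^3 \<Rightarrow> real" where
  "model_dist \<kappa> u v = arccos (u \<bullet> v) / sqrt \<kappa>"

definition geodesic_triangle_wrt ::
  "('b \<Rightarrow> 'b \<Rightarrow> real) \<Rightarrow> 'b set \<Rightarrow> 'b \<Rightarrow> 'b \<Rightarrow> 'b \<Rightarrow>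
     (real \<Rightarrow> 'b) \<Rightarrow> (real \<Rightarrow> 'b) \<Rightarrow> (real \<Rightarrow> 'b) \<Rightarrow> bool" where
  "geodesic_triangle_wrt d M p q r g h k \<longleftrightarrow>
     joins_wrt d M g p q \<and> joins_wrt d M h p r \<and> joins_wrt d M k q r"

text \<open>The comparison point of \<open>g s\<close> is \<open>g' s\<close>, at the same distance \<open>s\<close> from the common vertex.
  Comparing points on the two sides issuing at \<open>p\<close> suffices: relabelling the vertices covers the
  other pairs of sides, and points on one side have the same distance as their comparison points.\<close>

definition CAT :: "'a::metric_space itself \<Rightarrow> real \<Rightarrow> bool" where
  "CAT _ \<kappa> \<longleftrightarrow>
     (\<forall>p q :: 'a. dist p q < pi / sqrt \<kappa> \<longrightarrow> (\<exists>g. joins g p q)) \<and>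
     (\<forall>(p::'a) q r g h k p' q' r' g' h' k'.
        geodesic_triangle_wrt dist UNIV p q r g h k \<and>
        dist p q + dist p r + dist q r < 2 * pi / sqrt \<kappa> \<and>
        geodesic_triangle_wrt (model_dist \<kappa>) model_sphere p' q' r' g' h' k' \<and>
        model_dist \<kappa> p' q' = dist p q \<and>
        model_dist \<kappa> p' r' = dist p r \<and>
        model_dist \<kappa> q' r' = dist q r \<longrightarrow>
        (\<forall>s\<in>{0..dist p q}. \<forall>t\<in>{0..dist p r}. dist (g s) (h t) \<le> model_dist \<kappa> (g' s) (h' t)))"

section \<open>Tangent spaces\<close>

definition comparison_angle :: "'a::metric_space \<Rightarrow> 'a \<Rightarrow> 'a \<Rightarrow> real" where
  "comparison_angle x y z =
     arccos (((dist x y)\<^sup>2 + (dist x z)\<^sup>2 - (dist y z)\<^sup>2) / (2 * dist x y * dist x z))"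

text \<open>The limes superior as \<open>s, t\<close> tend to 0 from the right, independently of each other. It is
  taken in \<^typ>\<open>ereal\<close> because \<^const>\<open>Limsup\<close> requires a complete lattice; its value lies
  in \<open>[0, pi]\<close>.\<close>

definition alexandrov_angle :: "(real \<Rightarrow> 'a::metric_space) \<Rightarrow> (real \<Rightarrow> 'a) \<Rightarrow> real" where
  "alexandrov_angle g h =
     real_of_ereal (Limsup (at_right 0 \<times>\<^sub>F at_right 0)
       (\<lambda>(s, t). ereal (comparison_angle (g 0) (g s) (h t))))"

definition geodesics_at :: "'a::metric_space \<Rightarrow> ((real \<Rightarrow> 'a) \<times> real) set" where
  "geodesics_at x = {(g, l). 0 < l \<and> geodesic g l \<and> g 0 = x}"

definition same_direction ::
  "'a::metric_space \<Rightarrow> (((real \<Rightarrow> 'a) \<times> real) \<times> ((real \<Rightarrow> 'a) \<times> real)) set" where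
  "same_direction x =
     {(a, b). a \<in> geodesics_at x \<and> b \<in> geodesics_at x \<and> alexandrov_angle (fst a) (fst b) = 0}"

type_synonym 'a direction = "((real \<Rightarrow> 'a) \<times> real) set"

definition directions :: "'a::metric_space \<Rightarrow> 'a direction set" where
  "directions x = geodesics_at x // same_direction x"

definition direction_of :: "'a::metric_space \<Rightarrow> (real \<Rightarrow> 'a) \<Rightarrow> real \<Rightarrow> 'a direction" where
  "direction_of x g l = same_direction x `` {(g, l)}"

text \<open>The angle does not depend on the chosen representatives.\<close>

definition direction_angle :: "'a::metric_space direction \<Rightarrow> 'a direction \<Rightarrow> real" where
  "direction_angle \<xi> \<eta> =
     alexandrov_angle (fst (SOME a. a \<in> \<xi>)) (fst (SOME b. b \<in> \<eta>))"

text \<open>Points of the cone: pairs \<open>(\<xi>, r)\<close>, where all pairs with \<open>r = 0\<close> are identified to \<open>Apex\<close>.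
  \<open>Ray \<xi> r\<close> is used for \<open>r > 0\<close> only; \<open>cone_point\<close> forms the pair for arbitrary \<open>r \<ge> 0\<close>.
  The origin is present even if there are no directions.\<close>

datatype 'd cone = Apex | Ray 'd real

definition cone_point :: "'d \<Rightarrow> real \<Rightarrow> 'd cone" where
  "cone_point \<xi> r = (if r = 0 then Apex else Ray \<xi> r)"

type_synonym 'a tangent = "'a direction cone"

definition tangent_space :: "'a::metric_space \<Rightarrow> 'a tangent set" where
  "tangent_space x = insert Apex {cone_point \<xi> r | \<xi> r. \<xi> \<in> directions x \<and> 0 \<le> r}"

definition tangent_vector :: "'a::metric_space \<Rightarrow> (real \<Rightarrow> 'a) \<Rightarrow> real \<Rightarrow> real \<Rightarrow> 'a tangent" where
  "tangent_vector x g l r = cone_point (direction_of x g l) r"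

fun tangent_inner :: "'a::metric_space tangent \<Rightarrow> 'a tangent \<Rightarrow> real" where
  "tangent_inner (Ray \<xi> r) (Ray \<eta> s) = r * s * cos (direction_angle \<xi> \<eta>)"
| "tangent_inner _ _ = 0"

text \<open>The vector given by the geodesic from \<open>x\<close> to \<open>y\<close> and the number \<open>dist x y\<close>; for \<open>y = x\<close> this
  is the origin.\<close>

definition tangent_to :: "'a::metric_space \<Rightarrow> 'a \<Rightarrow> 'a tangent" where
  "tangent_to x y = tangent_vector x (geodesic_to x y) (dist x y) (dist x y)"

section \<open>Normal cones\<close>

definition metric_proj :: "'a::metric_space set \<Rightarrow> 'a \<Rightarrow> 'a set" where
  "metric_proj C z = {c \<in> C. dist z c = infdist z C}"

text \<open>This is intended for nonempty convex \<open>C\<close> and \<open>y \<in> C\<close>; membership is required for some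
  representative of the vector, as usual for a set of the form \<open>{([g], r). ...}\<close>.\<close>

definition normal_cone :: "'a::metric_space set \<Rightarrow> 'a \<Rightarrow> 'a tangent set" where
  "normal_cone C y = insert Apex
     {tangent_vector y g l r | g l r. (g, l) \<in> geodesics_at y \<and> 0 \<le> r \<and>
        (r = 0 \<or> (\<exists>t\<in>{0<..l}. metric_proj C (g t) = {y}))}"

section \<open>Convex functions and subdifferentials\<close>

text \<open>Functions with values in \<open>(-\<infinity>, \<infinity>]\<close> are functions into \<^typ>\<open>ereal\<close> that avoid \<open>-\<infinity>\<close>.
  In \<^typ>\<open>ereal\<close>, \<open>0 * \<infinity> = 0\<close>, so the convexity inequality is trivial for \<open>t = 0\<close> and \<open>t = 1\<close>.\<close>

definition geodesically_convex_fun :: "('a::metric_space \<Rightarrow> ereal) \<Rightarrow> bool" where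
  "geodesically_convex_fun f \<longleftrightarrow>
     (\<forall>g l. geodesic g l \<longrightarrow> (\<forall>t\<in>{0..1}.
        f (g (l * t)) \<le> ereal (1 - t) * f (g 0) + ereal t * f (g l)))"

definition effective_domain :: "('a \<Rightarrow> ereal) \<Rightarrow> 'a set" where
  "effective_domain f = {x. f x < \<infinity>}"

definition epigraph :: "('a \<Rightarrow> ereal) \<Rightarrow> ('a \<times> real) set" where
  "epigraph f = {(x, \<mu>). x \<in> effective_domain f \<and> f x \<le> ereal \<mu>}"

definition descent_path ::
  "('a \<Rightarrow> ereal) \<Rightarrow> 'a \<Rightarrow> (real \<Rightarrow> 'a) \<Rightarrow> real \<Rightarrow> real \<Rightarrow> 'a \<times> real" where
  "descent_path f x g r t =
     (g (r * t / sqrt (r\<^sup>2 + 1)), real_of_ereal (f x) - t / sqrt (r\<^sup>2 + 1))"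

text \<open>The number \<open>R\<close> is the geodesic extension constant at \<open>x\<close>, and representatives of directions are
  taken of length at least \<open>R\<close>. For the origin the constant path is allowed as a representative.
  The metric of \<open>'a \<times> real\<close> is the library's product metric, which is the
  \<open>\<ell>\<^sup>2\<close> product.\<close>

definition subdifferential ::
  "real \<Rightarrow> ('a::metric_space \<Rightarrow> ereal) \<Rightarrow> 'a \<Rightarrow> 'a tangent set" where
  "subdifferential R f x =
     {tangent_vector x g l r | g l r.
        0 \<le> r \<and> ((g, l) \<in> geodesics_at x \<and> R \<le> l \<or> r = 0 \<and> g = (\<lambda>_. x)) \<and>
        tangent_vector (x, real_of_ereal (f x)) (descent_path f x g r) R 1
          \<in> normal_cone (epigraph f) (x, real_of_ereal (f x))}"

end

theory Submission
  imports Defs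
begin

text \<open>Write \<open>\<sigma>\<close> for the descending path of slope given by \<open>([\<gamma>], r)\<close>. In the product with the real line, the
  inequality at \<open>y\<close> says that \<open>\<sigma>\<close> makes an angle of at least \<open>pi / 2\<close> with the segment from \<open>(x, f x)\<close> to
  \<open>(y, f y)\<close>. If the angle is acute, then the segment, which lies in the epigraph, comes closer than
  \<open>\<epsilon>\<close> to \<open>\<sigma> \<epsilon>\<close>, by the definition of the Alexandrov angle alone; so the vertex is not the projection.
  Conversely, the spherical law of cosines for the Alexandrov angle bounds the distance of \<open>\<gamma> a\<close> from
  \<open>y\<close> below, and for small \<open>a\<close> this bound suffices to make \<open>(x, f x)\<close> the unique nearest point of the
  epigraph to \<open>\<sigma> t\<close>. The product is never treated as a CAT space: its vertical part enters through
  Pythagoras only.\<close>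

section \<open>Alexandrov angles\<close>

text \<open>Triangle inequalities, squared: \<open>dist y z\<close> lies between the absolute
  difference and the sum of the other two sides. For a degenerate triangle the quotient is 0 by
  division by zero.\<close>

lemma comparison_angle_arg:
  fixes x y z :: "'a::metric_space"
  shows "\<bar>((dist x y)\<^sup>2 + (dist x z)\<^sup>2 - (dist y z)\<^sup>2) / (2 * dist x y * dist x z)\<bar> \<le> 1"
proof (cases "x = y \<or> x = z")
  case False
  then have p: "dist x y > 0" "dist x z > 0" by auto
  have "(dist y z)\<^sup>2 \<le> (dist x y + dist x z)\<^sup>2"
    using dist_triangle[of y z x] by (intro power_mono) (auto simp: dist_commute)
  moreover have "(dist x y - dist x z)\<^sup>2 \<le> (dist y z)\<^sup>2"
    using dist_triangle[of x y z] dist_triangle[of x z y]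
    by (subst abs_le_square_iff[symmetric]) (auto simp: dist_commute)
  ultimately show ?thesis using p
    by (simp add: abs_le_iff divide_simps power2_eq_square algebra_simps)
qed auto

lemma comparison_angle_bounds: "0 \<le> comparison_angle x y z" "comparison_angle x y z \<le> pi"
  using comparison_angle_arg[of x y z] unfolding comparison_angle_def abs_le_iff
  by (intro arccos_lbound arccos_ubound; linarith)+

text \<open>As \<open>cos\<close> decreases on [0, pi], angle bounds become bounds on squared
  distances, the form used in later estimates.\<close>

lemma comparison_angle_le_iff:
  assumes "x \<noteq> y" "x \<noteq> z" "0 \<le> b" "b \<le> pi"
  shows "comparison_angle x y z \<le> b \<longleftrightarrow>
    (dist y z)\<^sup>2 \<le> (dist x y)\<^sup>2 + (dist x z)\<^sup>2 - 2 * dist x y * dist x z * cos b"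
proof -
  have "comparison_angle x y z \<le> b \<longleftrightarrow> cos b \<le> cos (comparison_angle x y z)"
    using assms comparison_angle_bounds[of x y z] by (simp add: cos_mono_le_eq)
  also have "cos (comparison_angle x y z) =
      ((dist x y)\<^sup>2 + (dist x z)\<^sup>2 - (dist y z)\<^sup>2) / (2 * dist x y * dist x z)"
    unfolding comparison_angle_def using comparison_angle_arg[of x y z] by (intro cos_arccos_abs)
  finally show ?thesis using assms by (auto simp: divide_simps algebra_simps)
qed

text \<open>Comparison angles lie between 0 and \<open>pi\<close>, so the upper limit is finite and
  \<open>real_of_ereal\<close> returns its true value. The lower bound uses that the product filter
  is proper.\<close>

lemma ereal_alexandrov_angle:
  "ereal (alexandrov_angle g h) = Limsup (at_right 0 \<times>\<^sub>F at_right 0)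
      (\<lambda>(s, t). ereal (comparison_angle (g 0) (g s) (h t)))" (is "_ = ?L")
  and alexandrov_angle_bounds: "0 \<le> alexandrov_angle g h" "alexandrov_angle g h \<le> pi"
proof -
  have nb: "(at_right (0::real) \<times>\<^sub>F at_right (0::real)) \<noteq> bot"
    by (simp add: prod_filter_eq_bot)
  have 1: "?L \<le> ereal pi"
    by (rule Limsup_bounded) (auto intro!: always_eventually simp: comparison_angle_bounds)
  have 2: "ereal 0 \<le> ?L"
    by (rule le_Limsup[OF nb]) (auto intro!: always_eventually simp: comparison_angle_bounds)
  show e: "ereal (alexandrov_angle g h) = ?L"
    unfolding alexandrov_angle_def using 1 2 by (cases ?L) auto
  show "0 \<le> alexandrov_angle g h" "alexandrov_angle g h \<le> pi"
    using 1 2 unfolding e[symmetric] by auto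
qed

lemma eventually_at_right_prod_iff:
  "eventually P (at_right (0::real) \<times>\<^sub>F at_right (0::real)) \<longleftrightarrow>
    (\<exists>e>0. \<forall>s t. 0 < s \<and> s < e \<and> 0 < t \<and> t < e \<longrightarrow> P (s, t))" (is "?l \<longleftrightarrow> ?r")
proof
  assume ?l
  then obtain P1 P2 where "eventually P1 (at_right (0::real))" "eventually P2 (at_right (0::real))"
    and P: "\<And>s t. P1 s \<Longrightarrow> P2 t \<Longrightarrow> P (s, t)"
    unfolding eventually_prod_filter by blast
  then obtain a b where "a > 0" "\<And>s. 0 < s \<Longrightarrow> s < a \<Longrightarrow> P1 s" "b > 0" "\<And>s. 0 < s \<Longrightarrow> s < b \<Longrightarrow> P2 s"
    unfolding eventually_at_right_field by auto
  with P show ?r by (intro exI[of _ "min a b"]) auto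
next
  assume ?r
  then obtain e where "e > 0" "\<And>s t. 0 < s \<and> s < e \<and> 0 < t \<and> t < e \<Longrightarrow> P (s, t)" by blast
  then show ?l unfolding eventually_prod_filter
    by (intro exI[of _ "\<lambda>s. 0 < s \<and> s < e"]) (auto simp: eventually_at_right_field)
qed

lemma alexandrov_angle_lessD:
  assumes "alexandrov_angle g h < b"
  obtains e where "e > 0"
    "\<And>s t. 0 < s \<Longrightarrow> s < e \<Longrightarrow> 0 < t \<Longrightarrow> t < e \<Longrightarrow> comparison_angle (g 0) (g s) (h t) < b"
proof -
  have "\<forall>\<^sub>F z in at_right 0 \<times>\<^sub>F at_right 0.
      (\<lambda>(s, t). ereal (comparison_angle (g 0) (g s) (h t))) z < ereal b"
    by (rule Limsup_lessD) (use assms in \<open>simp flip: ereal_alexandrov_angle\<close>)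
  then show thesis using that unfolding eventually_at_right_prod_iff by auto
qed

lemma alexandrov_angle_leI:
  assumes "e > 0"
    "\<And>s t. 0 < s \<Longrightarrow> s < e \<Longrightarrow> 0 < t \<Longrightarrow> t < e \<Longrightarrow> comparison_angle (g 0) (g s) (h t) \<le> b"
  shows "alexandrov_angle g h \<le> b"
proof -
  have "Limsup (at_right 0 \<times>\<^sub>F at_right 0)
      (\<lambda>(s, t). ereal (comparison_angle (g 0) (g s) (h t))) \<le> ereal b"
    by (rule Limsup_bounded) (use assms in \<open>auto simp: eventually_at_right_prod_iff\<close>)
  then show ?thesis unfolding ereal_alexandrov_angle[symmetric] by simp
qed

lemma geodesics_at_dist:
  assumes "(g, l) \<in> geodesics_at x" "0 \<le> s" "s \<le> l" "0 \<le> t" "t \<le> l"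
  shows "dist (g s) (g t) = \<bar>s - t\<bar>" "dist x (g t) = t" "dist (g t) x = t"
proof -
  have *: "\<forall>s\<in>{0..l}. \<forall>t\<in>{0..l}. dist (g s) (g t) = \<bar>s - t\<bar>" and "g 0 = x" "0 < l"
    using assms(1) unfolding geodesics_at_def geodesic_wrt_def by auto
  then show "dist (g s) (g t) = \<bar>s - t\<bar>" using assms by auto
  have "dist (g 0) (g t) = t" using bspec[OF bspec[OF *, of 0], of t] assms \<open>0 < l\<close> by auto
  then show "dist x (g t) = t" "dist (g t) x = t" using \<open>g 0 = x\<close> by (auto simp: dist_commute)
qed

lemma geodesics_at_comparison_le_iff:
  assumes "(g, l) \<in> geodesics_at x" "(h, m) \<in> geodesics_at x"
    and "0 < s" "s \<le> l" "0 < t" "t \<le> m" "0 \<le> b" "b \<le> pi"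
  shows "comparison_angle x (g s) (h t) \<le> b \<longleftrightarrow>
    (dist (g s) (h t))\<^sup>2 \<le> s\<^sup>2 + t\<^sup>2 - 2 * s * t * cos b"
proof -
  have d: "dist x (g s) = s" "dist x (h t) = t"
    using geodesics_at_dist(2)[OF assms(1), of s s] geodesics_at_dist(2)[OF assms(2), of t t] assms
    by auto
  then have "x \<noteq> g s" "x \<noteq> h t" using assms by auto
  from comparison_angle_le_iff[OF this assms(7,8)] show ?thesis unfolding d .
qed

lemma geodesics_at_start: "(g, l) \<in> geodesics_at x \<Longrightarrow> g 0 = x" "(g, l) \<in> geodesics_at x \<Longrightarrow> 0 < l"
  unfolding geodesics_at_def by auto

lemma alexandrov_angle_commute:
  assumes "g 0 = h 0"
  shows "alexandrov_angle g h = alexandrov_angle h g"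
proof -
  have c: "comparison_angle x y z = comparison_angle x z y" for x y z :: 'a
    unfolding comparison_angle_def by (simp add: dist_commute algebra_simps)
  have "alexandrov_angle g h \<le> alexandrov_angle h g" if "g 0 = h 0" for g h :: "real \<Rightarrow> 'a"
  proof (rule dense_ge)
    fix b assume "alexandrov_angle h g < b"
    then obtain e where "e > 0"
      "\<And>s t. 0 < s \<Longrightarrow> s < e \<Longrightarrow> 0 < t \<Longrightarrow> t < e \<Longrightarrow> comparison_angle (h 0) (h s) (g t) < b"
      using alexandrov_angle_lessD by blast
    then show "alexandrov_angle g h \<le> b"
      using that c by (intro alexandrov_angle_leI[of e]) (auto intro: less_imp_le)
  qed
  then show ?thesis using assms by (metis order_antisym)
qed

lemma alexandrov_angle_eq_0:
  assumes "(g, l) \<in> geodesics_at x" "(h, m) \<in> geodesics_at x" "u > 0" "u \<le> l" "u \<le> m"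
    and "\<And>t. 0 \<le> t \<Longrightarrow> t \<le> u \<Longrightarrow> h t = g t"
  shows "alexandrov_angle g h = 0"
proof -
  have "alexandrov_angle g h \<le> 0"
  proof (rule alexandrov_angle_leI[OF assms(3)])
    fix s t assume st: "0 < s" "s < u" "0 < t" "t < u"
    have "(dist (g s) (h t))\<^sup>2 \<le> s\<^sup>2 + t\<^sup>2 - 2 * s * t * cos 0"
      using geodesics_at_dist(1)[OF assms(1), of s t] assms(6)[of t] st assms(4)
      by (simp add: power2_eq_square algebra_simps)
    then show "comparison_angle (g 0) (g s) (h t) \<le> 0"
      using geodesics_at_comparison_le_iff[OF assms(1,2), of s t 0] st assms(4,5)
      by (simp add: geodesics_at_start(1)[OF assms(1)])
  qed
  then show ?thesis using alexandrov_angle_bounds[of g h] by linarith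
qed

section \<open>The triangle inequality for Alexandrov angles\<close>

lemma cmod_cis_diff:
  "(cmod (of_real s * cis a - of_real t * cis b))\<^sup>2 = s\<^sup>2 + t\<^sup>2 - 2 * s * t * cos (a - b)"
proof -
  have "(cmod (of_real s * cis a - of_real t * cis b))\<^sup>2 =
      (s * cos a - t * cos b)\<^sup>2 + (s * sin a - t * sin b)\<^sup>2"
    by (simp add: cmod_power2)
  also have "\<dots> = s\<^sup>2 * ((cos a)\<^sup>2 + (sin a)\<^sup>2) + t\<^sup>2 * ((cos b)\<^sup>2 + (sin b)\<^sup>2)
      - 2 * s * t * (cos a * cos b + sin a * sin b)"
    by algebra
  finally show ?thesis by (simp add: cos_diff)
qed

text \<open>In the plane, the ray that divides the angle \<open>a + b\<close> meets the opposite
  side at distance \<open>\<tau>\<close> from the vertex and cuts that side into two lengths that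
  add up. The bound by \<open>max s t\<close> keeps \<open>\<tau>\<close> in the range where
  comparison angles are controlled.\<close>

lemma split_planar_triangle:
  fixes s t a b :: real
  assumes "0 < s" "0 < t" "0 < a" "0 < b" "a + b < pi"
  obtains \<tau> where "0 < \<tau>" "\<tau> \<le> max s t"
    "sqrt (s\<^sup>2 + t\<^sup>2 - 2 * s * t * cos (a + b)) =
       sqrt (s\<^sup>2 + \<tau>\<^sup>2 - 2 * s * \<tau> * cos a) + sqrt (\<tau>\<^sup>2 + t\<^sup>2 - 2 * \<tau> * t * cos b)"
proof -
  \<comment> \<open>The vertex is 0 and the dividing ray is the positive real axis; the end points
    lie at angles \<open>a\<close> and \<open>- b\<close>.\<close>
  define x where "x = of_real s * cis a"
  define z where "z = of_real t * cis (- b)"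
  have sin: "sin a > 0" "sin b > 0" "sin (a + b) > 0" using assms by (auto intro!: sin_gt_zero)
  define D where "D = s * sin a + t * sin b"
  have D: "D > 0" unfolding D_def using sin assms by (simp add: add_pos_pos)
  \<comment> \<open>The weight for which the imaginary part of
    \<open>(1 - \<mu>) * x + \<mu> * z\<close> vanishes; \<open>\<tau>\<close> is the remaining real
    part.\<close>
  define \<mu> where "\<mu> = s * sin a / D"
  have \<mu>': "1 - \<mu> = t * sin b / D" using D unfolding \<mu>_def by (simp add: divide_simps) (simp add: D_def)
  have \<mu>: "0 \<le> \<mu>" "0 \<le> 1 - \<mu>" unfolding \<mu>' unfolding \<mu>_def using sin assms D by auto
  define \<tau> where "\<tau> = s * t * sin (a + b) / D"
  have w: "of_real \<tau> = of_real (1 - \<mu>) * x + of_real \<mu> * z"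
  proof (rule complex_eqI)
    show "Re (of_real \<tau>) = Re (of_real (1 - \<mu>) * x + of_real \<mu> * z)"
      unfolding \<mu>' unfolding \<mu>_def x_def z_def \<tau>_def using D
      by (simp add: sin_add field_simps)
    show "Im (of_real \<tau>) = Im (of_real (1 - \<mu>) * x + of_real \<mu> * z)"
      unfolding \<mu>' unfolding \<mu>_def x_def z_def \<tau>_def using D by (simp add: field_simps)
  qed
  have pos: "\<tau> > 0" unfolding \<tau>_def using D sin assms by simp
  have "\<tau> = cmod (of_real \<tau>)" using pos by simp
  also have "\<dots> \<le> (1 - \<mu>) * s + \<mu> * t"
    unfolding w using \<mu> assms
    by (intro order_trans[OF norm_triangle_ineq]) (simp add: norm_mult x_def z_def del: of_real_diff)
  also have "\<dots> \<le> (1 - \<mu>) * max s t + \<mu> * max s t"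
    using \<mu> by (intro add_mono mult_left_mono) auto
  finally have le: "\<tau> \<le> max s t" by (simp add: algebra_simps)
  have "cmod (x - of_real \<tau>) = \<mu> * cmod (x - z)"
  proof -
    have "x - of_real \<tau> = of_real \<mu> * (x - z)" unfolding w by (simp add: algebra_simps)
    then show ?thesis using \<mu> by (simp add: norm_mult)
  qed
  moreover have "cmod (of_real \<tau> - z) = (1 - \<mu>) * cmod (x - z)"
  proof -
    have "of_real \<tau> - z = of_real (1 - \<mu>) * (x - z)" unfolding w by (simp add: algebra_simps)
    then show ?thesis using \<mu> by (simp add: norm_mult del: of_real_diff)
  qed
  ultimately have sum: "cmod (x - z) = cmod (x - of_real \<tau>) + cmod (of_real \<tau> - z)"
    by (simp add: algebra_simps)
  have "cmod (x - z) = sqrt (s\<^sup>2 + t\<^sup>2 - 2 * s * t * cos (a + b))"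
    using cmod_cis_diff[of s a t "-b"] unfolding x_def z_def by (intro real_sqrt_unique[symmetric]) auto
  moreover have "cmod (x - of_real \<tau>) = sqrt (s\<^sup>2 + \<tau>\<^sup>2 - 2 * s * \<tau> * cos a)"
    using cmod_cis_diff[of s a \<tau> 0] unfolding x_def by (intro real_sqrt_unique[symmetric]) auto
  moreover have "cmod (of_real \<tau> - z) = sqrt (\<tau>\<^sup>2 + t\<^sup>2 - 2 * \<tau> * t * cos b)"
    using cmod_cis_diff[of \<tau> 0 t "-b"] unfolding z_def by (intro real_sqrt_unique[symmetric]) auto
  ultimately show thesis using that[OF pos le] sum by simp
qed

text \<open>If it failed, angles \<open>a\<close> and \<open>b\<close> slightly above the two
  summands would still add up to less than \<open>alexandrov_angle g k\<close>. Splitting a planar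
  triangle with angle \<open>a + b\<close> then contradicts the triangle inequality for
  \<open>g s\<close>, \<open>h \<tau>\<close>, \<open>k t\<close>.\<close>

lemma alexandrov_angle_triangle:
  assumes g: "(g, l) \<in> geodesics_at x" and h: "(h, m) \<in> geodesics_at x" and k: "(k, n) \<in> geodesics_at x"
  shows "alexandrov_angle g k \<le> alexandrov_angle g h + alexandrov_angle h k"
proof (rule ccontr)
  assume neg: "\<not> ?thesis"
  \<comment> \<open>A third of the defect: with \<open>\<delta>\<close> added to each summand,
    \<open>a + b\<close> still falls short of the angle by \<open>\<delta>\<close>, and so stays
    below \<open>pi\<close>.\<close>
  define \<delta> where "\<delta> = (alexandrov_angle g k - alexandrov_angle g h - alexandrov_angle h k) / 3"
  define a where "a = alexandrov_angle g h + \<delta>"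
  define b where "b = alexandrov_angle h k + \<delta>"
  have \<delta>: "\<delta> > 0" using neg unfolding \<delta>_def by simp
  have ab: "0 < a" "0 < b" "a + b < alexandrov_angle g k" "a + b < pi"
    using \<delta> alexandrov_angle_bounds[of g h] alexandrov_angle_bounds[of h k] alexandrov_angle_bounds[of g k]
    unfolding a_def b_def by (auto simp: \<delta>_def field_simps)
  obtain e1 where e1: "e1 > 0"
    "\<And>s t. 0 < s \<Longrightarrow> s < e1 \<Longrightarrow> 0 < t \<Longrightarrow> t < e1 \<Longrightarrow> comparison_angle (g 0) (g s) (h t) < a"
    using alexandrov_angle_lessD[of g h a] \<delta> unfolding a_def by auto
  obtain e2 where e2: "e2 > 0"
    "\<And>s t. 0 < s \<Longrightarrow> s < e2 \<Longrightarrow> 0 < t \<Longrightarrow> t < e2 \<Longrightarrow> comparison_angle (h 0) (h s) (k t) < b"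
    using alexandrov_angle_lessD[of h k b] \<delta> unfolding b_def by auto
  note start = geodesics_at_start[OF g] geodesics_at_start[OF h] geodesics_at_start[OF k]
  define e where "e = min (min e1 e2) (min l (min m n))"
  have e: "e > 0" "e \<le> e1" "e \<le> e2" "e \<le> l" "e \<le> m" "e \<le> n"
    using e1(1) e2(1) start unfolding e_def by auto
  obtain s t where st: "0 < s" "s < e" "0 < t" "t < e" "comparison_angle (g 0) (g s) (k t) > a + b"
    using alexandrov_angle_leI[OF e(1), of g k "a + b"] ab(3) by (meson not_le)
  obtain \<tau> where \<tau>: "0 < \<tau>" "\<tau> \<le> max s t"
    "sqrt (s\<^sup>2 + t\<^sup>2 - 2 * s * t * cos (a + b)) =
       sqrt (s\<^sup>2 + \<tau>\<^sup>2 - 2 * s * \<tau> * cos a) + sqrt (\<tau>\<^sup>2 + t\<^sup>2 - 2 * \<tau> * t * cos b)"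
    using split_planar_triangle[OF st(1,3) ab(1,2,4)] by blast
  have \<tau>e: "\<tau> < e" using \<tau>(2) st by simp
  have "(dist (g s) (h \<tau>))\<^sup>2 \<le> s\<^sup>2 + \<tau>\<^sup>2 - 2 * s * \<tau> * cos a"
    using geodesics_at_comparison_le_iff[OF g h, of s \<tau> a] e1(2)[of s \<tau>] st \<tau>(1) \<tau>e e ab start by auto
  then have "dist (g s) (h \<tau>) \<le> sqrt (s\<^sup>2 + \<tau>\<^sup>2 - 2 * s * \<tau> * cos a)" by (rule real_le_rsqrt)
  moreover have "(dist (h \<tau>) (k t))\<^sup>2 \<le> \<tau>\<^sup>2 + t\<^sup>2 - 2 * \<tau> * t * cos b"
    using geodesics_at_comparison_le_iff[OF h k, of \<tau> t b] e2(2)[of \<tau> t] st \<tau>(1) \<tau>e e ab start by auto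
  then have "dist (h \<tau>) (k t) \<le> sqrt (\<tau>\<^sup>2 + t\<^sup>2 - 2 * \<tau> * t * cos b)" by (rule real_le_rsqrt)
  moreover have "(dist (g s) (k t))\<^sup>2 > s\<^sup>2 + t\<^sup>2 - 2 * s * t * cos (a + b)"
    using geodesics_at_comparison_le_iff[OF g k, of s t "a + b"] st e ab start by auto
  then have "dist (g s) (k t) > sqrt (s\<^sup>2 + t\<^sup>2 - 2 * s * t * cos (a + b))"
    by (rule real_less_lsqrt[rotated -1]) auto
  ultimately show False using dist_triangle[of "g s" "k t" "h \<tau>"] \<tau>(3) by linarith
qed

text \<open>Replacing a path by one at angle 0 costs nothing in the triangle inequality; doing so in
  both arguments and both directions gives equality.\<close>

lemma alexandrov_angle_cong:
  assumes g: "(g, l) \<in> geodesics_at x" "(g', l') \<in> geodesics_at x" "alexandrov_angle g g' = 0"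
    and h: "(h, m) \<in> geodesics_at x" "(h', m') \<in> geodesics_at x" "alexandrov_angle h h' = 0"
  shows "alexandrov_angle g h = alexandrov_angle g' h'"
proof -
  note start = assms(1,2,4,5)[THEN geodesics_at_start(1)]
  have "alexandrov_angle g' g = 0" "alexandrov_angle h' h = 0"
    using g(3) h(3) alexandrov_angle_commute[of g g'] alexandrov_angle_commute[of h h'] start by auto
  then show ?thesis
    using alexandrov_angle_triangle[OF g(1,2) h(1)] alexandrov_angle_triangle[OF g(2,1) h(1)]
      alexandrov_angle_triangle[OF g(2) h(1,2)] alexandrov_angle_triangle[OF g(2) h(2,1)] g(3) h(3)
    by linarith
qed

section \<open>Directions as classes of geodesics, and the scalar product\<close>

lemma equiv_same_direction: "equiv (geodesics_at x) (same_direction x)"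
proof (rule equivI)
  show "refl_on (geodesics_at x) (same_direction x)"
    unfolding refl_on_def same_direction_def
    by (auto intro: alexandrov_angle_eq_0[OF _ _ geodesics_at_start(2)])
  show "same_direction x \<subseteq> geodesics_at x \<times> geodesics_at x"
    unfolding same_direction_def by auto
  show "sym (same_direction x)"
    unfolding sym_def same_direction_def
    by (auto simp: alexandrov_angle_commute geodesics_at_start(1))
  show "trans (same_direction x)"
  proof (rule transI)
    fix a b c assume "(a, b) \<in> same_direction x" "(b, c) \<in> same_direction x"
    then show "(a, c) \<in> same_direction x"
      using alexandrov_angle_triangle[of "fst a" "snd a" x "fst b" "snd b" "fst c" "snd c"]
        alexandrov_angle_bounds(1)[of "fst a" "fst c"]
      unfolding same_direction_def by auto
  qed
qed

lemma direction_of_eqD: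
  assumes "direction_of x g l = direction_of x h m" "(h, m) \<in> geodesics_at x"
  shows "alexandrov_angle g h = 0"
proof -
  have "(h, m) \<in> direction_of x h m"
    unfolding direction_of_def using equiv_class_self[OF equiv_same_direction assms(2)] .
  then have "(h, m) \<in> direction_of x g l" using assms(1) by simp
  then show ?thesis unfolding direction_of_def same_direction_def by auto
qed

lemma direction_of_eqI:
  assumes "(g, l) \<in> geodesics_at x" "(h, m) \<in> geodesics_at x" "alexandrov_angle g h = 0"
  shows "direction_of x g l = direction_of x h m"
  unfolding direction_of_def
  by (rule equiv_class_eq[OF equiv_same_direction]) (use assms in \<open>auto simp: same_direction_def\<close>)

text \<open>The representatives chosen by \<open>direction_angle\<close> have angle 0 with the given
  geodesics, so the exchange does not alter the angle.\<close>

lemma direction_angle_direction_of: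
  assumes g: "(g, l) \<in> geodesics_at x" and h: "(h, m) \<in> geodesics_at x"
  shows "direction_angle (direction_of x g l) (direction_of x h m) = alexandrov_angle g h"
proof -
  have "(SOME a. a \<in> direction_of x g l) \<in> direction_of x g l" if "(g, l) \<in> geodesics_at x" for g l
    using equiv_class_self[OF equiv_same_direction that]
    unfolding direction_of_def by (metis someI)
  then have *: "(SOME a. a \<in> direction_of x g l) \<in> geodesics_at x \<and>
      alexandrov_angle g (fst (SOME a. a \<in> direction_of x g l)) = 0"
    if "(g, l) \<in> geodesics_at x" for g l
    using that unfolding direction_of_def same_direction_def by fastforce
  show ?thesis unfolding direction_angle_def
    using *[OF g] *[OF h] g h
    by (intro alexandrov_angle_cong[symmetric, where l' = "snd (SOME a. a \<in> direction_of x g l)"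
          and m' = "snd (SOME a. a \<in> direction_of x h m)"]) auto
qed

text \<open>An upper limit strictly below a bound controls all comparison angles near 0, hence the
  squared distances; this is why \<open>K\<close> stays strictly below the cosine.\<close>

lemma alexandrov_angle_hinge:
  assumes g: "(g, l) \<in> geodesics_at x" and h: "(h, m) \<in> geodesics_at x"
    and K: "K < cos (alexandrov_angle g h)"
  obtains e where "0 < e"
    "\<And>s t. 0 < s \<Longrightarrow> s < e \<Longrightarrow> 0 < t \<Longrightarrow> t < e \<Longrightarrow> (dist (g s) (h t))\<^sup>2 \<le> s\<^sup>2 + t\<^sup>2 - 2 * s * t * K"
proof -
  \<comment> \<open>\<open>K\<close> may lie below -1, where it is no cosine; the clamped value
    gives \<open>b = pi\<close>, which bounds every comparison angle.\<close>
  define b where "b = arccos (max (-1) K)"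
  note ab = alexandrov_angle_bounds[of g h]
  have K1: "K < 1" using K cos_le_one[of "alexandrov_angle g h"] by linarith
  then have b: "0 \<le> b" "b \<le> pi" "cos b = max (-1) K"
    unfolding b_def by (auto intro!: arccos_lbound arccos_ubound cos_arccos)
  have "\<exists>e>0. \<forall>s t. 0 < s \<longrightarrow> s < e \<longrightarrow> 0 < t \<longrightarrow> t < e \<longrightarrow> comparison_angle (g 0) (g s) (h t) \<le> b"
  proof (cases "K \<le> -1")
    case True
    then have "b = pi" unfolding b_def by simp
    then show ?thesis by (intro exI[of _ 1]) (simp add: comparison_angle_bounds)
  next
    case False
    then have "cos b < cos (alexandrov_angle g h)" using K b by simp
    then have "alexandrov_angle g h < b" using b(1,2) ab cos_mono_less_eq by blast
    then show ?thesis using alexandrov_angle_lessD less_imp_le by metis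
  qed
  then obtain e where e: "e > 0"
    "\<And>s t. 0 < s \<Longrightarrow> s < e \<Longrightarrow> 0 < t \<Longrightarrow> t < e \<Longrightarrow> comparison_angle (g 0) (g s) (h t) \<le> b"
    by blast
  show thesis
  proof (rule that)
    show "0 < min e (min l m)" using e geodesics_at_start(2)[OF g] geodesics_at_start(2)[OF h] by simp
    fix s t assume st: "0 < s" "s < min e (min l m)" "0 < t" "t < min e (min l m)"
    have "(dist (g s) (h t))\<^sup>2 \<le> s\<^sup>2 + t\<^sup>2 - 2 * s * t * cos b"
      using geodesics_at_comparison_le_iff[OF g h, of s t b] e(2)[of s t] st b(1,2)
      by (simp add: geodesics_at_start(1)[OF g])
    moreover have "2 * s * t * K \<le> 2 * s * t * cos b"
      using st unfolding b(3) by (intro mult_left_mono) auto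
    ultimately show "(dist (g s) (h t))\<^sup>2 \<le> s\<^sup>2 + t\<^sup>2 - 2 * s * t * K" by linarith
  qed
qed

lemma tangent_inner_tangent_vector:
  assumes "(g, l) \<in> geodesics_at x" "(h, m) \<in> geodesics_at x"
  shows "tangent_inner (tangent_vector x g l r) (tangent_vector x h m s) =
    r * s * cos (alexandrov_angle g h)"
  unfolding tangent_vector_def cone_point_def using direction_angle_direction_of[OF assms] by simp

section \<open>Hinges on the sphere\<close>

text \<open>The difference of the sides vanishes at 0 and has derivative \<open>x * sin x\<close>.
  It decides the sign of the derivative of \<open>sin x / x\<close>.\<close>

lemma x_cos_le_sin:
  fixes x :: real
  assumes "0 \<le> x" "x \<le> pi"
  shows "x * cos x \<le> sin x"
proof -
  have "(\<lambda>x. sin x - x * cos x) 0 \<le> (\<lambda>x. sin x - x * cos x) x"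
  proof (rule DERIV_nonneg_imp_nondecreasing[OF assms(1)])
    fix y assume "0 \<le> y" "y \<le> x"
    then show "\<exists>D. ((\<lambda>x. sin x - x * cos x) has_real_derivative D) (at y) \<and> 0 \<le> D"
      using assms by (intro exI[of _ "y * sin y"]) (auto intro!: derivative_eq_intros mult_nonneg_nonneg sin_ge_zero)
  qed
  then show ?thesis by simp
qed

lemma sin_div_antimono:
  fixes x y :: real
  assumes "0 < x" "x \<le> y" "y \<le> pi"
  shows "sin y / y \<le> sin x / x"
proof (rule DERIV_nonpos_imp_nonincreasing[OF assms(2), where f = "\<lambda>x. sin x / x"])
  fix z assume "x \<le> z" "z \<le> y"
  then show "\<exists>D. ((\<lambda>x. sin x / x) has_real_derivative D) (at z) \<and> D \<le> 0"
    using assms x_cos_le_sin[of z]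
    by (intro exI[of _ "(cos z * z - sin z) / (z * z)"])
      (auto intro!: derivative_eq_intros divide_nonpos_nonneg simp: mult.commute)
qed

text \<open>The graph of the convex function \<open>w \<mapsto> cos (sqrt w)\<close> on \<open>[0, pi\<^sup>2]\<close> lies above its tangents.\<close>

lemma cos_sqrt_tangent:
  fixes a d :: real
  assumes a: "0 < a" "a \<le> pi" and d: "0 \<le> d" "d \<le> pi"
  shows "cos d \<ge> cos a - sin a / (2 * a) * (d\<^sup>2 - a\<^sup>2)"
proof -
  \<comment> \<open>Cosine minus its tangent as a function of the square, up to a constant. The
    derivative is \<open>z\<close> times \<open>sin a / a - sin z / z\<close>, so \<open>f\<close>
    falls up to \<open>a\<close> and rises after it.\<close>
  define f where "f = (\<lambda>z. cos z + sin a / (2 * a) * z\<^sup>2)"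
  have der: "(f has_real_derivative (sin a / a * z - sin z)) (at z)" for z
    unfolding f_def using a by (auto intro!: derivative_eq_intros)
  have "f a \<le> f d"
  proof (cases "a \<le> d")
    case True
    show ?thesis
    proof (rule DERIV_nonneg_imp_nondecreasing[OF True])
      fix z assume z: "a \<le> z" "z \<le> d"
      have "sin z / z \<le> sin a / a" using sin_div_antimono[of a z] z a d by auto
      then have "0 \<le> sin a / a * z - sin z" using z a by (simp add: pos_divide_le_eq)
      then show "\<exists>D. (f has_real_derivative D) (at z) \<and> 0 \<le> D" using der by blast
    qed
  next
    case False
    then have "d \<le> a" by simp
    then show ?thesis
    proof (rule DERIV_nonpos_imp_nonincreasing)
      fix z assume z: "d \<le> z" "z \<le> a"
      have "sin a / a * z \<le> sin z"
      proof (cases "z = 0")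
        case False
        then show ?thesis using sin_div_antimono[of z a] z a d by (simp add: pos_le_divide_eq)
      qed simp
      then show "\<exists>D. (f has_real_derivative D) (at z) \<and> D \<le> 0" using der by fastforce
    qed
  qed
  then show ?thesis unfolding f_def by (simp add: algebra_simps)
qed

text \<open>With weights \<open>(1 + c) / 2\<close> and \<open>(1 - c) / 2\<close>, both sides are averages over \<open>s - t\<close> and \<open>s + t\<close>, and
  \<open>w \<mapsto> cos (sqrt w)\<close> is convex.\<close>

lemma spherical_hinge_le_euclidean:
  fixes s t c d :: real
  assumes st: "0 \<le> s" "0 \<le> t" "s + t \<le> pi" and c: "\<bar>c\<bar> \<le> 1" and d: "0 \<le> d" "d \<le> pi"
    and cos: "cos s * cos t + sin s * sin t * c \<le> cos d"
  shows "d\<^sup>2 \<le> s\<^sup>2 + t\<^sup>2 - 2 * s * t * c"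
proof -
  define p where "p = (1 + c) / 2"
  define q where "q = (1 - c) / 2"
  have pq: "p \<ge> 0" "q \<ge> 0" "p + q = 1" using c unfolding p_def q_def by (auto simp: field_simps)
  define E where "E = s\<^sup>2 + t\<^sup>2 - 2 * s * t * c"
  have E: "E = p * (s - t)\<^sup>2 + q * (s + t)\<^sup>2"
    unfolding E_def p_def q_def by (simp add: power2_eq_square field_simps)
  have S: "cos s * cos t + sin s * sin t * c = p * cos \<bar>s - t\<bar> + q * cos (s + t)"
    unfolding p_def q_def by (simp add: cos_add cos_diff field_simps)
  have E0: "E \<ge> 0" unfolding E using pq by simp
  have m: "\<bar>s - t\<bar> \<le> s + t" using st by auto
  have sq: "(s - t)\<^sup>2 \<le> (s + t)\<^sup>2" using m st by (subst abs_le_square_iff[symmetric]) auto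
  have "E \<le> p * (s + t)\<^sup>2 + q * (s + t)\<^sup>2"
    unfolding E using pq sq by (intro add_mono mult_left_mono) auto
  also have "\<dots> = (s + t)\<^sup>2" using pq(3) by (metis distrib_right mult_1)
  finally have "sqrt E \<le> s + t" using st by (intro real_le_lsqrt) auto
  then have Epi: "sqrt E \<le> pi" using st by simp
  have "cos (sqrt E) \<le> p * cos \<bar>s - t\<bar> + q * cos (s + t)"
  proof (cases "E = 0")
    case True
    then have z: "p * (s - t)\<^sup>2 = 0" "q * (s + t)\<^sup>2 = 0"
      unfolding E using pq by (auto simp: add_nonneg_eq_0_iff)
    then have "p * cos \<bar>s - t\<bar> = p" "q * cos (s + t) = q" by auto
    then have "p * cos \<bar>s - t\<bar> + q * cos (s + t) = 1" using pq(3) by metis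
    then show ?thesis using True by simp
  next
    case False
    \<comment> \<open>\<open>- C\<close> is the slope of \<open>cos (sqrt w)\<close> at
      \<open>w = E\<close>. The first-order terms cancel because \<open>E\<close> is the weighted
      mean of the two squares.\<close>
    define C where "C = sin (sqrt E) / (2 * sqrt E)"
    have pos: "sqrt E > 0" using False E0 by simp
    have "cos (sqrt E) - C * ((s - t)\<^sup>2 - E) \<le> cos \<bar>s - t\<bar>"
      using cos_sqrt_tangent[OF pos Epi, of "\<bar>s - t\<bar>"] m st E0 unfolding C_def by simp
    moreover have "cos (sqrt E) - C * ((s + t)\<^sup>2 - E) \<le> cos (s + t)"
      using cos_sqrt_tangent[OF pos Epi, of "s + t"] st E0 unfolding C_def by simp
    ultimately have "p * (cos (sqrt E) - C * ((s - t)\<^sup>2 - E)) + q * (cos (sqrt E) - C * ((s + t)\<^sup>2 - E))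
        \<le> p * cos \<bar>s - t\<bar> + q * cos (s + t)"
      using pq by (intro add_mono mult_left_mono) auto
    moreover have "p * (cos (sqrt E) - C * ((s - t)\<^sup>2 - E)) + q * (cos (sqrt E) - C * ((s + t)\<^sup>2 - E))
        = (p + q) * cos (sqrt E) - C * ((p * (s - t)\<^sup>2 + q * (s + t)\<^sup>2) - (p + q) * E)"
      by (simp add: algebra_simps)
    ultimately show ?thesis using pq(3) E by simp
  qed
  then have "cos (sqrt E) \<le> cos d" using cos S by simp
  then have "d \<le> sqrt E" using d Epi E0 by (simp add: cos_mono_le_eq)
  then have "d\<^sup>2 \<le> (sqrt E)\<^sup>2" using d by (intro power_mono)
  then show ?thesis using E0 unfolding E_def by simp
qed

text \<open>The decisive estimate: for small sides, the law of cosines of the sphere loses less against the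
  Euclidean one than the term \<open>u\<^sup>2\<close> that the latter has to spare.\<close>

lemma spherical_hinge_lower_bound:
  fixes a u c d :: real
  assumes a: "0 < a" "a \<le> 1 / 2" and u: "0 < u" "u \<le> 1" and c: "\<bar>c\<bar> \<le> 1" and d: "0 \<le> d" "d \<le> pi"
    and cos: "cos d \<le> cos a * cos u + sin a * sin u * c"
  shows "a\<^sup>2 - 2 * a * u * c < d\<^sup>2"
proof -
  have api: "a \<le> pi" using a pi_gt3 by auto
  have sa: "sin a > 0" using a pi_gt3 by (intro sin_gt_zero) auto
  have sal: "sin a \<le> 1 / 2" using a sin_x_le_x[of a] by auto
  have ca: "1 / 2 \<le> cos a"
  proof -
    have "\<bar>sin a\<bar> \<le> 1/2" using sa sal by simp
    then have "(sin a)\<^sup>2 \<le> (1/2)\<^sup>2" using power_mono[of "\<bar>sin a\<bar>" "1/2" 2] by simp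
    then have "(1/2)\<^sup>2 \<le> (cos a)\<^sup>2" using sin_cos_squared_add[of a] by (simp add: power2_eq_square)
    moreover have "cos a \<ge> 0" using a pi_gt3 by (intro cos_ge_zero) auto
    ultimately show ?thesis using power2_le_imp_le by blast
  qed
  \<comment> \<open>Compares the losses \<open>1 - cos z\<close> and \<open>z - sin z\<close>; the
    derivative is positive because the square of \<open>sin z + cos z\<close> is
    \<open>1 + 2 * sin z * cos z\<close>.\<close>
  define F where "F = (\<lambda>z::real. 1 - cos z - (z - sin z))"
  have "F 0 < F u"
  proof (rule DERIV_pos_imp_increasing_open[OF u(1)])
    fix z assume z: "0 < z" "z < u"
    have "(F has_real_derivative (sin z + cos z - 1)) (at z)"
      unfolding F_def by (auto intro!: derivative_eq_intros)
    moreover have "sin z + cos z - 1 > 0"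
    proof -
      have p: "sin z > 0" "cos z > 0"
        using z u pi_gt3 by (auto intro!: sin_gt_zero cos_gt_zero)
      have "(sin z + cos z)\<^sup>2 = 1 + 2 * sin z * cos z"
        using sin_cos_squared_add[of z] by (simp add: power2_eq_square algebra_simps)
      then have "1\<^sup>2 < (sin z + cos z)\<^sup>2" using p by simp
      then show ?thesis using power_less_imp_less_base[of 1 2 "sin z + cos z"] p by simp
    qed
    ultimately show "\<exists>D. (F has_real_derivative D) (at z) \<and> 0 < D" by blast
  qed (auto simp: F_def intro!: continuous_intros)
  then have F: "u - sin u < 1 - cos u" unfolding F_def by simp
  have us: "0 \<le> u - sin u" using sin_x_le_x[of u] u by simp
  \<comment> \<open>The worst case is \<open>c = -1\<close>; there
    \<open>sin a \<le> 1 / 2 \<le> cos a\<close> and the comparison of losses decide the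
    sign.\<close>
  have key: "0 < cos a * (1 - cos u) + sin a * (u - sin u) * c"
  proof -
    have "sin a * (u - sin u) * (- c) \<le> sin a * (u - sin u) * 1"
      using c sa us by (intro mult_left_mono) auto
    also have "\<dots> \<le> (1 / 2) * (u - sin u)" using mult_right_mono[OF sal us] by simp
    also have "\<dots> < (1 / 2) * (1 - cos u)" using F by simp
    also have "\<dots> \<le> cos a * (1 - cos u)" using ca F us by (intro mult_right_mono) auto
    finally show ?thesis by simp
  qed
  \<comment> \<open>The tangent at \<open>a\<close> bounds \<open>cos d\<close> from below, the
    hypothesis bounds it from above; \<open>key\<close> then trades \<open>sin u\<close> for
    \<open>u\<close>.\<close>
  have "cos a - sin a / (2 * a) * (d\<^sup>2 - a\<^sup>2) \<le> cos a * cos u + sin a * sin u * c"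
    using cos_sqrt_tangent[OF a(1) api d] cos by linarith
  moreover have "sin a / (2 * a) * (- 2 * a * u * c) = - (sin a * u * c)" using a by simp
  ultimately have "sin a / (2 * a) * (- 2 * a * u * c) < sin a / (2 * a) * (d\<^sup>2 - a\<^sup>2)"
    using key by (simp only: right_diff_distrib left_diff_distrib mult_1_right)
  then have "- 2 * a * u * c < d\<^sup>2 - a\<^sup>2"
    by (rule mult_left_less_imp_less) (use sa a in simp)
  then show ?thesis by simp
qed

section \<open>The law of cosines in CAT spaces\<close>

text \<open>As \<open>e\<close> and \<open>w\<close> are orthonormal, the inner product of two
  points is the cosine of \<open>sqrt \<kappa>\<close> times the parameter difference;
  \<open>arccos\<close> recovers this up to \<open>pi\<close>.\<close>

lemma great_circle_joins:
  fixes e w :: "real^3"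
  assumes k: "\<kappa> > 0" and n: "norm e = 1" "norm w = 1" "e \<bullet> w = 0"
    and l: "0 \<le> l" "sqrt \<kappa> * l \<le> pi"
    and g: "g = (\<lambda>s. cos (sqrt \<kappa> * s) *\<^sub>R e + sin (sqrt \<kappa> * s) *\<^sub>R w)"
  shows "joins_wrt (model_dist \<kappa>) model_sphere g e (g l)" "model_dist \<kappa> e (g l) = l"
proof -
  have ew: "e \<bullet> e = 1" "w \<bullet> w = 1" "w \<bullet> e = 0"
    using n by (auto simp: dot_square_norm inner_commute)
  have i: "g s \<bullet> g t = cos (sqrt \<kappa> * (s - t))" for s t
    unfolding g using ew n(3)
    by (simp add: inner_add_left inner_add_right right_diff_distrib cos_diff)
  have d: "model_dist \<kappa> (g s) (g t) = \<bar>s - t\<bar>" if "s \<in> {0..l}" "t \<in> {0..l}" for s t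
  proof -
    have "sqrt \<kappa> * \<bar>s - t\<bar> \<le> sqrt \<kappa> * l" using that k by (intro mult_left_mono) auto
    then have "sqrt \<kappa> * \<bar>s - t\<bar> \<le> pi" using l by simp
    then have "arccos (cos (sqrt \<kappa> * \<bar>s - t\<bar>)) = sqrt \<kappa> * \<bar>s - t\<bar>"
      using k by (intro arccos_cos) auto
    moreover have "cos (sqrt \<kappa> * \<bar>s - t\<bar>) = cos (sqrt \<kappa> * (s - t))"
      using k by (metis abs_mult abs_of_pos cos_abs_real real_sqrt_gt_zero)
    ultimately show ?thesis unfolding model_dist_def i using k by simp
  qed
  have g0: "g 0 = e" unfolding g by simp
  show dl: "model_dist \<kappa> e (g l) = l" using d[of 0 l] l g0 by simp
  have "norm (g s) = 1" for s using i[of s s] by (simp add: norm_eq_1)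
  then show "joins_wrt (model_dist \<kappa>) model_sphere g e (g l)"
    unfolding joins_wrt_def geodesic_wrt_def dl model_sphere_def using d g0 l by auto
qed

text \<open>Gram-Schmidt applied to \<open>v\<close> gives the initial direction of a great circle
  from \<open>u\<close>. Antipodal points, which determine no direction, are excluded; equal points
  take the constant path.\<close>

lemma model_sphere_joins:
  assumes k: "\<kappa> > 0" and u: "u \<in> model_sphere" "v \<in> model_sphere" and uv: "-1 < u \<bullet> v"
  obtains g where "joins_wrt (model_dist \<kappa>) model_sphere g u v"
proof (cases "u \<bullet> v = 1")
  case True
  have n: "norm u = 1" "norm v = 1" using u unfolding model_sphere_def by auto
  then have "u = v" using True by (intro vector_eq[THEN iffD2]) (simp add: dot_square_norm)
  moreover have "model_dist \<kappa> u u = 0" unfolding model_dist_def using n by (simp add: dot_square_norm)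
  ultimately have "joins_wrt (model_dist \<kappa>) model_sphere (\<lambda>_. u) u v"
    using u unfolding joins_wrt_def geodesic_wrt_def by auto
  then show thesis by (rule that)
next
  case False
  have n: "norm u = 1" "norm v = 1" using u unfolding model_sphere_def by auto
  have dot: "u \<bullet> u = 1" "v \<bullet> v = 1" "v \<bullet> u = u \<bullet> v"
    using n by (simp_all add: dot_square_norm inner_commute[of v u])
  have "u \<bullet> v \<le> 1" using norm_cauchy_schwarz[of u v] n by simp
  then have lt: "u \<bullet> v < 1" using False by simp
  define \<theta> where "\<theta> = arccos (u \<bullet> v)"
  have \<theta>: "0 < \<theta>" "\<theta> < pi" "cos \<theta> = u \<bullet> v"
    unfolding \<theta>_def using arccos_lt_bounded[OF uv lt] uv lt by (auto simp: cos_arccos)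
  have s: "sin \<theta> > 0" using \<theta> by (intro sin_gt_zero)
  define w where "w = (1 / sin \<theta>) *\<^sub>R (v - cos \<theta> *\<^sub>R u)"
  have uw: "u \<bullet> w = 0" unfolding w_def using dot \<theta> by (simp add: inner_diff_right)
  have "(v - cos \<theta> *\<^sub>R u) \<bullet> (v - cos \<theta> *\<^sub>R u) = (sin \<theta>)\<^sup>2"
    unfolding sin_squared_eq using dot
    by (simp add: inner_diff_left inner_diff_right \<theta>(3)[symmetric] power2_eq_square)
  then have "w \<bullet> w = 1" unfolding w_def using s by (simp add: power2_eq_square)
  then have nw: "norm w = 1" by (simp add: norm_eq_1)
  define g where "g = (\<lambda>s. cos (sqrt \<kappa> * s) *\<^sub>R u + sin (sqrt \<kappa> * s) *\<^sub>R w)"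
  have "g (\<theta> / sqrt \<kappa>) = v" unfolding g_def w_def using k s by simp
  moreover have "joins_wrt (model_dist \<kappa>) model_sphere g u (g (\<theta> / sqrt \<kappa>))"
    using k \<theta> by (intro great_circle_joins[OF k n(1) nw uw _ _ g_def]) auto
  ultimately show thesis using that by simp
qed

text \<open>The angle \<open>\<beta>\<close> of the comparison triangle satisfies the law of cosines
  exactly. The CAT inequality near \<open>x\<close>, followed by the Euclidean bound on spherical
  hinges, shows that comparison angles, hence the Alexandrov angle, are at most
  \<open>\<beta>\<close>.\<close>

lemma CAT_law_of_cosines:
  fixes x y z :: "'a::metric_space"
  assumes k: "\<kappa> > 0" and CAT: "CAT TYPE('a) \<kappa>"
    and g: "joins g x y" and h: "joins h x z" and ne: "x \<noteq> y" "x \<noteq> z"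
    and per: "dist x y + dist x z + dist y z < 2 * pi / sqrt \<kappa>"
  shows "cos (sqrt \<kappa> * dist y z) \<le> cos (sqrt \<kappa> * dist x y) * cos (sqrt \<kappa> * dist x z) +
    sin (sqrt \<kappa> * dist x y) * sin (sqrt \<kappa> * dist x z) * cos (alexandrov_angle g h)"
proof -
  define q where "q = sqrt \<kappa>"
  have q: "q > 0" unfolding q_def using k by simp
  define A where "A = q * dist x y"
  define U where "U = q * dist x z"
  define D where "D = q * dist y z"
  have per': "A + U + D < 2 * pi"
    using per q unfolding A_def U_def D_def q_def[symmetric] by (simp add: field_simps)
  have tri: "A \<le> U + D" "U \<le> A + D" "D \<le> A + U"
    using mult_left_mono[OF dist_triangle[of x y z], of q] mult_left_mono[OF dist_triangle[of x z y], of q]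
      mult_left_mono[OF dist_triangle[of y z x], of q] q
    unfolding A_def U_def D_def by (auto simp: algebra_simps dist_commute)
  have pos: "A > 0" "U > 0" "D \<ge> 0" using ne q unfolding A_def U_def D_def by auto
  \<comment> \<open>By the triangle inequalities each side is at most half the perimeter.\<close>
  have lt: "A < pi" "U < pi" "D < pi" using per' tri by auto
  have s: "sin A > 0" "sin U > 0" using pos lt by (auto intro: sin_gt_zero)
  \<comment> \<open>The cosine of the comparison angle, solved from the spherical law of cosines;
    the bounds that follow make it an actual cosine.\<close>
  define c where "c = (cos D - cos A * cos U) / (sin A * sin U)"
  have cD: "cos D = cos A * cos U + sin A * sin U * c" unfolding c_def using s by simp
  have "cos D \<le> cos \<bar>A - U\<bar>" using tri lt pos by (intro cos_monotone_0_pi_le) auto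
  then have "cos D \<le> cos (A - U)" by simp
  then have "sin A * sin U * c \<le> sin A * sin U * 1" using cD by (simp add: cos_diff)
  then have c1: "c \<le> 1" by (rule mult_left_le_imp_le) (use s in simp)
  have "cos (A + U) \<le> cos D"
  proof (cases "A + U \<le> pi")
    case True
    then show ?thesis using tri pos by (intro cos_monotone_0_pi_le) auto
  next
    case False
    \<comment> \<open>Beyond \<open>pi\<close> the cosine increases again, so the perimeter bound
      takes the place of the triangle inequality.\<close>
    have "cos (2 * pi - (A + U)) \<le> cos D" using False per' pos by (intro cos_monotone_0_pi_le) auto
    then show ?thesis by (simp add: cos_diff)
  qed
  then have "sin A * sin U * (-1) \<le> sin A * sin U * c" using cD by (simp add: cos_add)
  then have c2: "-1 \<le> c" by (rule mult_left_le_imp_le) (use s in simp)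
  define \<beta> where "\<beta> = arccos c"
  have \<beta>: "0 \<le> \<beta>" "\<beta> \<le> pi" "cos \<beta> = c"
    unfolding \<beta>_def using c1 c2 by (auto intro: arccos_lbound arccos_ubound)
  \<comment> \<open>The comparison triangle has vertex \<open>e1\<close> and sides in the directions
    \<open>e2\<close> and \<open>w\<close>, which make the angle \<open>\<beta>\<close>.\<close>
  define e1 e2 e3 :: "real^3" where "e1 = axis 1 1" and "e2 = axis 2 1" and "e3 = axis 3 1"
  have dot: "e1 \<bullet> e1 = 1" "e2 \<bullet> e2 = 1" "e3 \<bullet> e3 = 1" "e1 \<bullet> e2 = 0" "e1 \<bullet> e3 = 0" "e2 \<bullet> e3 = 0"
    "e2 \<bullet> e1 = 0" "e3 \<bullet> e1 = 0" "e3 \<bullet> e2 = 0"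
    unfolding e1_def e2_def e3_def by (auto simp: inner_axis_axis)
  define w where "w = cos \<beta> *\<^sub>R e2 + sin \<beta> *\<^sub>R e3"
  have w: "e1 \<bullet> w = 0" "w \<bullet> e1 = 0" "e2 \<bullet> w = c" "w \<bullet> w = 1"
    unfolding w_def using dot \<beta>(3) sin_cos_squared_add[of \<beta>]
    by (auto simp: inner_add_left inner_add_right power2_eq_square)
  define g' where "g' = (\<lambda>s. cos (sqrt \<kappa> * s) *\<^sub>R e1 + sin (sqrt \<kappa> * s) *\<^sub>R e2)"
  define h' where "h' = (\<lambda>s. cos (sqrt \<kappa> * s) *\<^sub>R e1 + sin (sqrt \<kappa> * s) *\<^sub>R w)"
  have g': "joins_wrt (model_dist \<kappa>) model_sphere g' e1 (g' (dist x y))"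
      "model_dist \<kappa> e1 (g' (dist x y)) = dist x y"
    using dot lt(1) A_def q_def
    by (auto intro!: great_circle_joins[OF k _ _ _ _ _ g'_def] simp: norm_eq_1)
  have h': "joins_wrt (model_dist \<kappa>) model_sphere h' e1 (h' (dist x z))"
      "model_dist \<kappa> e1 (h' (dist x z)) = dist x z"
    using dot w lt(2) U_def q_def
    by (auto intro!: great_circle_joins[OF k _ _ _ _ _ h'_def] simp: norm_eq_1)
  have gh: "g' s \<bullet> h' t = cos (q * s) * cos (q * t) + sin (q * s) * sin (q * t) * c" for s t
    unfolding g'_def h'_def q_def using dot w by (simp add: inner_add_left inner_add_right)
  have unit: "norm (g' s) = 1" "norm (h' s) = 1" for s
    unfolding norm_eq_1 g'_def h'_def using dot w
    by (auto simp: inner_add_left inner_add_right power2_eq_square[symmetric])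
  have ghD: "g' (dist x y) \<bullet> h' (dist x z) = cos D"
    unfolding gh cD by (simp add: A_def U_def)
  \<comment> \<open>The two end points are not antipodal, so the comparison triangle has a third
    side, as \<open>CAT\<close> demands.\<close>
  have "cos pi < cos D" using lt pos by (intro cos_monotone_0_pi) auto
  then have "- 1 < g' (dist x y) \<bullet> h' (dist x z)" unfolding ghD by simp
  then obtain k' where k': "joins_wrt (model_dist \<kappa>) model_sphere k' (g' (dist x y)) (h' (dist x z))"
    using model_sphere_joins[OF k, of "g' (dist x y)" "h' (dist x z)"] unit
    unfolding model_sphere_def by auto
  have md: "model_dist \<kappa> (g' (dist x y)) (h' (dist x z)) = dist y z"
    unfolding model_dist_def ghD using lt pos q by (simp add: arccos_cos) (simp add: D_def q_def)
  have "dist y z < pi / sqrt \<kappa>" using lt(3) q unfolding D_def q_def[symmetric] by (simp add: field_simps)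
  then obtain j where j: "joins j y z" using CAT unfolding CAT_def by blast
  have cmp: "dist (g s) (h t) \<le> model_dist \<kappa> (g' s) (h' t)"
    if "s \<in> {0..dist x y}" "t \<in> {0..dist x z}" for s t
  proof -
    have "geodesic_triangle_wrt dist UNIV x y z g h j"
      "geodesic_triangle_wrt (model_dist \<kappa>) model_sphere e1 (g' (dist x y)) (h' (dist x z)) g' h' k'"
      unfolding geodesic_triangle_wrt_def using g h j g' h' k' by auto
    then show ?thesis
      using per g'(2) h'(2) md that
      by (intro CAT[unfolded CAT_def, THEN conjunct2, rule_format,
            of x y z g h j e1 "g' (dist x y)" "h' (dist x z)" g' h' k' s t] conjI)
  qed
  have gx: "(g, dist x y) \<in> geodesics_at x" and hx: "(h, dist x z) \<in> geodesics_at x"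
    using g h ne unfolding joins_wrt_def geodesics_at_def by auto
  have "alexandrov_angle g h \<le> \<beta>"
  proof (rule alexandrov_angle_leI)
    \<comment> \<open>\<open>pi / (2 * q)\<close> ensures \<open>q * s + q * t \<le> pi\<close> for
      the Euclidean bound; the other terms keep the points on the sides.\<close>
    let ?e = "min (pi / (2 * q)) (min (dist x y) (dist x z))"
    show "0 < ?e" using ne q by simp
    fix s t assume st: "0 < s" "s < ?e" "0 < t" "t < ?e"
    define d where "d = q * dist (g s) (h t)"
    have i: "\<bar>g' s \<bullet> h' t\<bar> \<le> 1" using Cauchy_Schwarz_ineq2[of "g' s" "h' t"] unit by simp
    have "d \<le> arccos (g' s \<bullet> h' t)"
      using cmp[of s t] st q unfolding d_def model_dist_def q_def[symmetric] by (simp add: field_simps)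
    moreover have "arccos (g' s \<bullet> h' t) \<le> pi" using i by (intro arccos_ubound) auto
    moreover have "d \<ge> 0" unfolding d_def using q by simp
    ultimately have "d \<le> pi" "cos (arccos (g' s \<bullet> h' t)) \<le> cos d"
      by (auto intro: cos_monotone_0_pi_le)
    then have "cos (q * s) * cos (q * t) + sin (q * s) * sin (q * t) * c \<le> cos d"
      using i gh by (simp add: cos_arccos_abs)
    moreover have "q * s + q * t \<le> pi"
    proof -
      have "q * s \<le> pi / 2" "q * t \<le> pi / 2" using st q by (auto simp: field_simps)
      then show ?thesis by simp
    qed
    ultimately have "d\<^sup>2 \<le> (q * s)\<^sup>2 + (q * t)\<^sup>2 - 2 * (q * s) * (q * t) * c"
      using st q c1 c2 \<open>0 \<le> d\<close> \<open>d \<le> pi\<close> by (intro spherical_hinge_le_euclidean) auto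
    then have "q\<^sup>2 * (dist (g s) (h t))\<^sup>2 \<le> q\<^sup>2 * (s\<^sup>2 + t\<^sup>2 - 2 * s * t * c)"
      unfolding d_def by (simp add: power2_eq_square algebra_simps)
    then have "(dist (g s) (h t))\<^sup>2 \<le> s\<^sup>2 + t\<^sup>2 - 2 * s * t * c"
      by (rule mult_left_le_imp_le) (use q in simp)
    then show "comparison_angle (g 0) (g s) (h t) \<le> \<beta>"
      using geodesics_at_comparison_le_iff[OF gx hx, of s t \<beta>] st \<beta> geodesics_at_start(1)[OF gx] by simp
  qed
  then have "c \<le> cos (alexandrov_angle g h)"
    using alexandrov_angle_bounds[of g h] \<beta> cos_monotone_0_pi_le by metis
  then have "cos D \<le> cos A * cos U + sin A * sin U * cos (alexandrov_angle g h)"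
    unfolding cD using s by simp
  then show ?thesis unfolding A_def U_def D_def q_def .
qed

text \<open>Scaling by \<open>sqrt \<kappa>\<close> leads to the unit sphere, where the lower bound
  for small hinges combines with the law of cosines for \<open>x\<close>, \<open>g a\<close>,
  \<open>y\<close>.\<close>

lemma CAT_hinge_lower_bound:
  fixes x y :: "'a::metric_space"
  assumes k: "\<kappa> > 0" and CAT: "CAT TYPE('a) \<kappa>" and g: "(g, l) \<in> geodesics_at x"
    and h: "joins h x y" and ne: "x \<noteq> y"
    and a: "0 < a" "a \<le> l" "sqrt \<kappa> * a \<le> 1 / 2" and u: "sqrt \<kappa> * dist x y \<le> 1"
  shows "a\<^sup>2 - 2 * a * dist x y * cos (alexandrov_angle g h) < (dist (g a) y)\<^sup>2"
proof -
  define q where "q = sqrt \<kappa>"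
  have q: "q > 0" unfolding q_def using k by simp
  have da: "dist x (g a) = a" using geodesics_at_dist(2)[OF g, of a a] a by simp
  have ga: "joins g x (g a)"
    using g a unfolding joins_wrt_def da geodesic_wrt_def geodesics_at_def by auto
  have tri: "dist (g a) y \<le> a + dist x y" using dist_triangle[of "g a" y x] da by (simp add: dist_commute)
  have qd: "q * dist (g a) y \<le> 3 / 2"
    using mult_left_mono[OF tri, of q] q a(3) u unfolding q_def[symmetric] by (simp add: algebra_simps)
  \<comment> \<open>The scaled sides are at most 1/2, 1 and 3/2, and their sum 3 is below
    \<open>2 * pi\<close>.\<close>
  have "q * (dist x (g a) + dist x y + dist (g a) y) < 2 * pi"
    using qd a(3) u pi_gt3 unfolding da q_def[symmetric] by (simp add: algebra_simps)
  then have "dist x (g a) + dist x y + dist (g a) y < 2 * pi / sqrt \<kappa>"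
    using q unfolding q_def[symmetric] by (simp add: field_simps)
  from CAT_law_of_cosines[OF k CAT ga h _ ne this] a
  have "cos (q * dist (g a) y) \<le> cos (q * a) * cos (q * dist x y)
      + sin (q * a) * sin (q * dist x y) * cos (alexandrov_angle g h)"
    unfolding da q_def[symmetric] using da by force
  then have "(q * a)\<^sup>2 - 2 * (q * a) * (q * dist x y) * cos (alexandrov_angle g h) < (q * dist (g a) y)\<^sup>2"
    using a u q ne qd pi_gt3 unfolding q_def[symmetric]
    by (intro spherical_hinge_lower_bound) auto
  then have "q\<^sup>2 * (a\<^sup>2 - 2 * a * dist x y * cos (alexandrov_angle g h)) < q\<^sup>2 * (dist (g a) y)\<^sup>2"
    by (simp add: power2_eq_square algebra_simps)
  then show ?thesis by (rule mult_left_less_imp_less) simp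
qed

section \<open>Normal vectors to epigraphs\<close>

lemma dist_descent_path_squared:
  assumes "f x = ereal F"
  shows "(dist (descent_path f x g r t) (y, F + m))\<^sup>2 =
    (dist (g (r * t / sqrt (r\<^sup>2 + 1))) y)\<^sup>2 + (t / sqrt (r\<^sup>2 + 1) + m)\<^sup>2"
proof -
  have "dist (F - t / sqrt (r\<^sup>2 + 1)) (F + m) = \<bar>t / sqrt (r\<^sup>2 + 1) + m\<bar>"
    by (simp add: dist_real_def abs_minus_commute)
  then show ?thesis unfolding descent_path_def dist_Pair_Pair by (simp add: assms)
qed

lemma metric_proj_eq_singletonI:
  assumes "p \<in> C" "\<And>c. c \<in> C \<Longrightarrow> c \<noteq> p \<Longrightarrow> dist z p < dist z c"
  shows "metric_proj C z = {p}"
proof -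
  have "dist z p \<le> dist z c" if "c \<in> C" for c
    using assms(2)[OF that] by (cases "c = p") auto
  then have "dist z p \<le> infdist z C"
    using assms(1) by (subst infdist_notempty) (auto intro: cINF_greatest)
  then have "infdist z C = dist z p" using infdist_le[OF assms(1), of z] by simp
  then show ?thesis using assms unfolding metric_proj_def by fastforce
qed

text \<open>The normal cone only provides some representative of the direction that projects to \<open>p\<close>. It
  separates from \<open>c\<close> at a sublinear rate, which is why \<open>\<rho> < 1\<close> has to be allowed.\<close>

lemma normal_direction_dist:
  assumes c: "(c, l) \<in> geodesics_at p" and n: "tangent_vector p c l 1 \<in> normal_cone C p"
    and \<rho>: "\<rho> < 1" and e: "0 < e"
  obtains \<epsilon> where "0 < \<epsilon>" "\<epsilon> < e" "\<And>q. q \<in> C \<Longrightarrow> \<rho> * \<epsilon> \<le> dist (c \<epsilon>) q"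
proof -
  obtain c' l' t where c': "(c', l') \<in> geodesics_at p" and eq: "direction_of p c l = direction_of p c' l'"
    and t: "0 < t" "t \<le> l'" and P: "metric_proj C (c' t) = {p}"
    using n unfolding normal_cone_def tangent_vector_def cone_point_def by (auto split: if_splits)
  define \<theta> where "\<theta> = 1 - \<rho>"
  have \<theta>: "\<theta> > 0" unfolding \<theta>_def using \<rho> by simp
  have "alexandrov_angle c c' = 0" using direction_of_eqD[OF eq c'] .
  \<comment> \<open>For \<open>s = t = \<epsilon>\<close> the hinge estimate with this constant
    becomes \<open>(\<theta> * \<epsilon>)\<^sup>2\<close>.\<close>
  then have "1 - \<theta>\<^sup>2 / 2 < cos (alexandrov_angle c c')" using \<theta> by simp
  then obtain e' where e': "0 < e'" "\<And>s t. 0 < s \<Longrightarrow> s < e' \<Longrightarrow> 0 < t \<Longrightarrow> t < e' \<Longrightarrow>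
      (dist (c s) (c' t))\<^sup>2 \<le> s\<^sup>2 + t\<^sup>2 - 2 * s * t * (1 - \<theta>\<^sup>2 / 2)"
    using alexandrov_angle_hinge[OF c c'] by blast
  define \<epsilon> where "\<epsilon> = min (min e e') t / 2"
  have \<epsilon>: "0 < \<epsilon>" "\<epsilon> < e" "\<epsilon> < e'" "\<epsilon> < t" unfolding \<epsilon>_def using e e'(1) t by auto
  show thesis
  proof (rule that[OF \<epsilon>(1,2)])
    fix q assume q: "q \<in> C"
    have "(dist (c \<epsilon>) (c' \<epsilon>))\<^sup>2 \<le> (\<theta> * \<epsilon>)\<^sup>2"
      using e'(2)[of \<epsilon> \<epsilon>] \<epsilon> by (simp add: power2_eq_square algebra_simps)
    then have 1: "dist (c \<epsilon>) (c' \<epsilon>) \<le> \<theta> * \<epsilon>" by (rule power2_le_imp_le) (use \<theta> \<epsilon> in simp)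
    have "dist (c' t) p = infdist (c' t) C" using P unfolding metric_proj_def by auto
    \<comment> \<open>Points of \<open>C\<close> keep distance \<open>t\<close> from
      \<open>c' t\<close>. Going back to \<open>c' \<epsilon>\<close> loses
      \<open>t - \<epsilon>\<close>, and passing to \<open>c \<epsilon>\<close> loses at most
      \<open>\<theta> * \<epsilon>\<close>.\<close>
    then have 2: "t \<le> dist (c' t) q"
      using infdist_le[OF q, of "c' t"] geodesics_at_dist(3)[OF c', of t t] t by simp
    have 3: "dist (c' t) (c' \<epsilon>) = t - \<epsilon>" using geodesics_at_dist(1)[OF c', of t \<epsilon>] t \<epsilon> by simp
    have "dist (c' t) q \<le> dist (c' t) (c' \<epsilon>) + (dist (c \<epsilon>) (c' \<epsilon>) + dist (c \<epsilon>) q)"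
      using dist_triangle[of "c' t" q "c' \<epsilon>"] dist_triangle3[of "c' \<epsilon>" q "c \<epsilon>"] by linarith
    then have "\<epsilon> - \<theta> * \<epsilon> \<le> dist (c \<epsilon>) q" using 1 2 3 by linarith
    then show "\<rho> * \<epsilon> \<le> dist (c \<epsilon>) q" unfolding \<theta>_def by (simp add: algebra_simps)
  qed
qed

text \<open>The horizontal speed \<open>r / N\<close> and the vertical speed \<open>1 / N\<close>
  have squares that sum to 1. For \<open>r = 0\<close> the motion is purely vertical.\<close>

lemma descent_path_geodesics_at:
  assumes R: "0 < R" and r: "0 \<le> r" and g0: "g 0 = x"
    and g: "r = 0 \<or> (\<forall>s\<in>{0..R}. \<forall>t\<in>{0..R}. dist (g s) (g t) = \<bar>s - t\<bar>)"
  shows "(descent_path f x g r, R) \<in> geodesics_at (x, real_of_ereal (f x))"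
proof -
  define N where "N = sqrt (r\<^sup>2 + 1)"
  have N2: "N\<^sup>2 = r\<^sup>2 + 1" unfolding N_def by simp
  have N: "N > 0" "r \<le> N"
    using power2_le_imp_le[of r N] N2 by (auto simp: N_def add_nonneg_pos)
  have "dist (descent_path f x g r s) (descent_path f x g r t) = \<bar>s - t\<bar>"
    if st: "s \<in> {0..R}" "t \<in> {0..R}" for s t
  proof -
    have range: "r * s / N \<in> {0..R}" if "s \<in> {0..R}" for s
    proof -
      have "r * s \<le> N * R" using that N r by (intro mult_mono) auto
      then show ?thesis using that N r by (simp add: field_simps)
    qed
    have "dist (g (r * s / N)) (g (r * t / N)) = \<bar>r * s / N - r * t / N\<bar>"
      using g range[OF st(1)] range[OF st(2)] by auto
    also have "\<dots> = r / N * \<bar>s - t\<bar>"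
      using r N by (simp add: diff_divide_distrib[symmetric] right_diff_distrib[symmetric] abs_mult)
    finally have 1: "dist (g (r * s / N)) (g (r * t / N)) = r / N * \<bar>s - t\<bar>" .
    have "real_of_ereal (f x) - s / N - (real_of_ereal (f x) - t / N) = (t - s) / N"
      by (simp add: diff_divide_distrib)
    then have 2: "dist (real_of_ereal (f x) - s / N) (real_of_ereal (f x) - t / N) = \<bar>s - t\<bar> / N"
      unfolding dist_real_def using N by (simp add: abs_minus_commute)
    have "(r / N * \<bar>s - t\<bar>)\<^sup>2 + (\<bar>s - t\<bar> / N)\<^sup>2 = (r\<^sup>2 + 1) * \<bar>s - t\<bar>\<^sup>2 / N\<^sup>2"
      by (simp add: power_mult_distrib power_divide algebra_simps add_divide_distrib)
    also have "\<dots> = \<bar>s - t\<bar>\<^sup>2" unfolding N2[symmetric] using N by simp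
    finally show ?thesis
      unfolding descent_path_def dist_Pair_Pair N_def[symmetric] 1 2 by simp
  qed
  moreover have "descent_path f x g r 0 = (x, real_of_ereal (f x))"
    unfolding descent_path_def using g0 by simp
  ultimately show ?thesis using R unfolding geodesics_at_def geodesic_wrt_def by auto
qed

lemma tangent_vector_normal_coneI:
  assumes "(c, l) \<in> geodesics_at p" "0 < t" "t \<le> l" "metric_proj C (c t) = {p}"
  shows "tangent_vector p c l 1 \<in> normal_cone C p"
  using assms unfolding normal_cone_def by fastforce

lemma geodesically_convex_fun_real:
  assumes "geodesically_convex_fun f" "joins h x y" "f x = ereal F" "f y = ereal G"
    and "0 \<le> s" "s \<le> dist x y" "x \<noteq> y"
  shows "f (h s) \<le> ereal (F + s * (G - F) / dist x y)"
proof -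
  define t where "t = s / dist x y"
  have t: "t \<in> {0..1}" "dist x y * t = s" unfolding t_def using assms by (auto simp: field_simps)
  have "geodesic h (dist x y)" "h 0 = x" "h (dist x y) = y" using assms(2) unfolding joins_wrt_def by auto
  then have "f (h s) \<le> ereal (1 - t) * ereal F + ereal t * ereal G"
    using assms(1,3,4) t unfolding geodesically_convex_fun_def by metis
  also have "\<dots> = ereal (F + s * (G - F) / dist x y)"
    unfolding t_def by (simp add: algebra_simps diff_divide_distrib)
  finally show ?thesis .
qed

text \<open>If the slope of \<open>f\<close> towards \<open>y\<close> were too small, then the chord of the epigraph over the geodesic
  \<open>h\<close> would make an acute angle with the normal direction and hence come too close to it.\<close>

lemma normal_epigraph_slope_bound:
  assumes conv: "geodesically_convex_fun f" and h: "joins h x y" and ne: "x \<noteq> y"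
    and fx: "f x = ereal F" and fy: "f y = ereal G" and r: "0 \<le> r"
    and c: "(descent_path f x g r, R) \<in> geodesics_at (x, F)"
    and n: "tangent_vector (x, F) (descent_path f x g r) R 1 \<in> normal_cone (epigraph f) (x, F)"
    and e: "0 < e" "\<And>s t. 0 < s \<Longrightarrow> s < e \<Longrightarrow> 0 < t \<Longrightarrow> t < e \<Longrightarrow>
      (dist (g (r * s)) (h t))\<^sup>2 \<le> (r * s)\<^sup>2 + t\<^sup>2 - 2 * (r * s) * t * K"
  shows "r * K \<le> (G - F) / dist x y"
proof (rule ccontr)
  assume neg: "\<not> ?thesis"
  define u where "u = dist x y"
  define m where "m = (G - F) / u"
  define N where "N = sqrt (r\<^sup>2 + 1)"
  have u: "u > 0" unfolding u_def using ne by simp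
  have N2: "N\<^sup>2 = r\<^sup>2 + 1" unfolding N_def by simp
  have N: "N \<ge> 1" using power2_le_imp_le[of 1 N] N2 by (auto simp: N_def)
  \<comment> \<open>Scalar product of the unit descent direction with the chord direction
    \<open>(1, m)\<close>, where \<open>K\<close> stands for the cosine; \<open>M\<close> is the
    squared length of the chord direction.\<close>
  define \<eta> where "\<eta> = (r * K - m) / N"
  have \<eta>: "\<eta> > 0" unfolding \<eta>_def using N neg by (simp add: m_def u_def)
  define M where "M = 1 + m\<^sup>2"
  have M: "M > 0" unfolding M_def by (simp add: add_pos_nonneg)
  \<comment> \<open>The path at time \<open>\<epsilon>\<close> comes within
    \<open>\<rho>0 * \<epsilon>\<close> of the chord, but normality keeps it at least
    \<open>\<rho> * \<epsilon>\<close> away from the epigraph for a small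
    \<open>\<epsilon>\<close>.\<close>
  define \<rho>0 where "\<rho>0 = sqrt (1 - \<eta>\<^sup>2 / M)"
  have \<rho>0: "\<rho>0 < 1" unfolding \<rho>0_def using \<eta> M by simp
  obtain \<rho> where \<rho>: "\<rho>0 < \<rho>" "\<rho> < 1" using dense[OF \<rho>0] by blast
  \<comment> \<open>The factor \<open>M / \<eta>\<close> turns the bounds wanted for
    \<open>s = \<eta> * \<epsilon> / M\<close> into one for \<open>\<epsilon>\<close>.\<close>
  define e' where "e' = min (min e R) (min e u * (M / \<eta>))"
  have R: "R > 0" using geodesics_at_start(2)[OF c] .
  have "e' > 0" unfolding e'_def using e(1) R u M \<eta> by simp
  then obtain \<epsilon> where \<epsilon>: "0 < \<epsilon>" "\<epsilon> < e'"
    and far: "\<And>q. q \<in> epigraph f \<Longrightarrow> \<rho> * \<epsilon> \<le> dist (descent_path f x g r \<epsilon>) q"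
    using normal_direction_dist[OF c n \<rho>(2)] by blast
  \<comment> \<open>Minimizes \<open>\<epsilon>\<^sup>2 + s\<^sup>2 * M - 2 * s * \<epsilon> *
    \<eta>\<close>: the foot of the perpendicular on the chord.\<close>
  define s where "s = \<eta> * \<epsilon> / M"
  have "\<epsilon> < min e u * (M / \<eta>)" using \<epsilon> unfolding e'_def by simp
  then have "\<epsilon> * \<eta> < min e u * M" using \<eta> by (simp add: pos_less_divide_eq)
  then have "s < min e u" unfolding s_def by (subst pos_divide_less_eq[OF M]) (simp add: mult.commute)
  then have s: "0 < s" "s < e" "s < u" using \<eta> \<epsilon> M by (auto simp: s_def)
  define q where "q = (h s, F + s * m)"
  have "f (h s) \<le> ereal (F + s * m)"
    using geodesically_convex_fun_real[OF conv h fx fy _ _ ne, of s] s unfolding m_def u_def by simp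
  then have q: "q \<in> epigraph f"
    unfolding q_def epigraph_def effective_domain_def by (auto intro: le_less_trans)
  have "\<epsilon> / N \<le> \<epsilon>" using N \<epsilon> by (simp add: divide_le_eq)
  moreover have "\<epsilon> < e" using \<epsilon> unfolding e'_def by simp
  ultimately have eN: "0 < \<epsilon> / N" "\<epsilon> / N < e" using N \<epsilon> by auto
  have hinge: "(dist (g (r * \<epsilon> / N)) (h s))\<^sup>2 \<le> (r * (\<epsilon> / N))\<^sup>2 + s\<^sup>2 - 2 * (r * (\<epsilon> / N)) * s * K"
    using e(2)[OF eN s(1,2)] by simp
  have "(dist (descent_path f x g r \<epsilon>) q)\<^sup>2 = (dist (g (r * \<epsilon> / N)) (h s))\<^sup>2 + (\<epsilon> / N + s * m)\<^sup>2"
    unfolding q_def dist_descent_path_squared[of f x F g, OF fx] N_def ..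
  also have "\<dots> \<le> (r * (\<epsilon> / N))\<^sup>2 + s\<^sup>2 - 2 * (r * (\<epsilon> / N)) * s * K + (\<epsilon> / N + s * m)\<^sup>2"
    using hinge by simp
  also have "\<dots> = (r\<^sup>2 + 1) * (\<epsilon> / N)\<^sup>2 + s\<^sup>2 * M - 2 * s * \<epsilon> * \<eta>"
    unfolding M_def \<eta>_def using N
    by (simp add: power2_eq_square algebra_simps add_divide_distrib diff_divide_distrib)
  also have "\<dots> = \<epsilon>\<^sup>2 + s\<^sup>2 * M - 2 * s * \<epsilon> * \<eta>" unfolding N2[symmetric] using N by (simp add: power_divide)
  also have "\<dots> = \<epsilon>\<^sup>2 * (1 - \<eta>\<^sup>2 / M)"
    unfolding s_def using M by (simp add: field_simps power2_eq_square)
  finally have "dist (descent_path f x g r \<epsilon>) q \<le> sqrt (\<epsilon>\<^sup>2 * (1 - \<eta>\<^sup>2 / M))" by (rule real_le_rsqrt)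
  also have "\<dots> = \<epsilon> * \<rho>0" unfolding \<rho>0_def real_sqrt_mult using \<epsilon> by simp
  also have "\<dots> < \<rho> * \<epsilon>" using \<rho> \<epsilon> by simp
  finally show False using far[OF q] by simp
qed

text \<open>Points of the epigraph at distance more than \<open>2 * t\<close> from the vertex are harmless, and for the
  others the hinge estimate applies.\<close>

lemma normal_epigraphI:
  fixes x :: "'a::metric_space"
  assumes k: "\<kappa> > 0" and CAT: "CAT TYPE('a) \<kappa>" and r: "0 \<le> r"
    and g: "r = 0 \<and> g 0 = x \<or> (g, R) \<in> geodesics_at x" and R: "0 < R"
    and h: "\<And>y. joins (h y) x y"
    and fx: "f x = ereal F"
    and sub: "\<And>y \<mu>. x \<noteq> y \<Longrightarrow> f y \<le> ereal \<mu> \<Longrightarrow> r * dist x y * cos (alexandrov_angle g (h y)) \<le> \<mu> - F"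
  shows "tangent_vector (x, F) (descent_path f x g r) R 1 \<in> normal_cone (epigraph f) (x, F)"
proof -
  define N where "N = sqrt (r\<^sup>2 + 1)"
  have N2: "N\<^sup>2 = r\<^sup>2 + 1" unfolding N_def by simp
  have N: "N \<ge> 1" "r \<le> N" using power2_le_imp_le[of 1 N] power2_le_imp_le[of r N] N2
    by (auto simp: N_def)
  have c: "(descent_path f x g r, R) \<in> geodesics_at (x, F)"
  proof -
    have "r = 0 \<or> (\<forall>s\<in>{0..R}. \<forall>t\<in>{0..R}. dist (g s) (g t) = \<bar>s - t\<bar>)" "g 0 = x"
      using g geodesics_at_dist(1)[of g R x] geodesics_at_start(1)[of g R x] by auto
    then show ?thesis using descent_path_geodesics_at[OF R r, of g x f] fx by simp
  qed
  \<comment> \<open>Then \<open>sqrt \<kappa> * t \<le> 1 / 2\<close>, and points within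
    \<open>2 * t\<close> have scaled distance at most 1: the ranges of the hinge bound.\<close>
  define t where "t = min R (1 / (2 * sqrt \<kappa>))"
  have t: "0 < t" "t \<le> R" unfolding t_def using R k by auto
  have "t \<le> 1 / (2 * sqrt \<kappa>)" unfolding t_def by simp
  then have kt: "sqrt \<kappa> * t \<le> 1 / 2" using k by (simp add: field_simps)
  define a where "a = r * t / N"
  have a: "0 \<le> a" "a \<le> t" unfolding a_def using r t N by (auto simp: divide_le_eq mult.commute mult_left_mono)
  have a2: "a\<^sup>2 + (t / N)\<^sup>2 = t\<^sup>2"
  proof -
    have "a\<^sup>2 + (t / N)\<^sup>2 = (r\<^sup>2 + 1) * t\<^sup>2 / N\<^sup>2"
      unfolding a_def by (simp add: power_divide power_mult_distrib algebra_simps add_divide_distrib)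
    then show ?thesis unfolding N2[symmetric] using N by simp
  qed
  have tp: "dist (descent_path f x g r t) (x, F) = t"
    using geodesics_at_dist(3)[OF c, of t t] t by simp
  have "metric_proj (epigraph f) (descent_path f x g r t) = {(x, F)}"
  proof (rule metric_proj_eq_singletonI)
    show "(x, F) \<in> epigraph f" unfolding epigraph_def effective_domain_def using fx by simp
    fix q assume q: "q \<in> epigraph f" "q \<noteq> (x, F)"
    obtain y \<mu> where y: "q = (y, \<mu>)" by (cases q)
    have f\<mu>: "f y \<le> ereal \<mu>" using q(1) unfolding y epigraph_def by simp
    define m where "m = \<mu> - F"
    define u where "u = dist x y"
    define A where "A = cos (alexandrov_angle g (h y))"
    show "dist (descent_path f x g r t) (x, F) < dist (descent_path f x g r t) q"
    proof (cases "2 * t < dist (x, F) q")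
      case True
      then show ?thesis
        using dist_triangle[of "(x, F)" q "descent_path f x g r t"] tp by (simp add: dist_commute)
    next
      case False
      have "dist x y \<le> 2 * t" using False dist_fst_le[of "(x, F)" q] y by simp
      then have "sqrt \<kappa> * dist x y \<le> sqrt \<kappa> * (2 * t)" using k by (intro mult_left_mono) auto
      then have ku: "sqrt \<kappa> * dist x y \<le> 1" using kt by simp
      have "sqrt \<kappa> * a \<le> sqrt \<kappa> * t" using k a by (intro mult_left_mono) auto
      then have ka: "sqrt \<kappa> * a \<le> 1 / 2" using kt by simp
      have key: "t\<^sup>2 < (dist (g a) y)\<^sup>2 + (m + t / N)\<^sup>2"
      proof (cases "x = y")
        case True
        then have "m > 0" using f\<mu> fx q(2) unfolding m_def y by auto
        then have "(t / N)\<^sup>2 < (m + t / N)\<^sup>2" using t N by (intro power_strict_mono) auto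
        moreover have "a = dist (g a) y"
        proof (cases "r = 0")
          case False
          then show ?thesis using g geodesics_at_dist(3)[of g R x a a] a t True by auto
        qed (use g a_def True in \<open>auto simp: geodesics_at_start(1)\<close>)
        ultimately show ?thesis using a2 by simp
      next
        case False
        have s: "r * u * A \<le> m" unfolding u_def A_def m_def using sub[OF False f\<mu>] .
        \<comment> \<open>Since \<open>a = r * (t / N)\<close>, this is the subgradient inequality
          multiplied by the vertical drop \<open>t / N\<close>.\<close>
        have "a * u * A = r * u * A * (t / N)" unfolding a_def by simp
        also have "\<dots> \<le> m * (t / N)" using t N by (intro mult_right_mono[OF s]) auto
        finally have au: "a * u * A \<le> m * (t / N)" .
        have hinge: "a\<^sup>2 - 2 * a * u * A < (dist (g a) y)\<^sup>2"
        proof (cases "r = 0")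
          case True
          then show ?thesis using False g unfolding a_def by (auto simp: geodesics_at_start(1))
        next
          case nz: False
          then have "a > 0" unfolding a_def using r t N by simp
          then show ?thesis
            using CAT_hinge_lower_bound[OF k CAT _ h False _ _ ka ku, of g R] g nz a t
            unfolding u_def A_def by auto
        qed
        have "t\<^sup>2 = a\<^sup>2 + (t / N)\<^sup>2" using a2 by simp
        also have "\<dots> < (dist (g a) y)\<^sup>2 + 2 * (m * (t / N)) + (t / N)\<^sup>2" using hinge au by simp
        also have "\<dots> \<le> (dist (g a) y)\<^sup>2 + (m + t / N)\<^sup>2" by (simp add: power2_sum mult.assoc)
        finally show ?thesis .
      qed
      have "(dist (descent_path f x g r t) q)\<^sup>2 = (dist (g a) y)\<^sup>2 + (m + t / N)\<^sup>2"
        using dist_descent_path_squared[of f x F g r t y m, OF fx]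
        unfolding y N_def a_def m_def by (simp add: add.commute)
      then have "t\<^sup>2 < (dist (descent_path f x g r t) q)\<^sup>2" using key by simp
      then show ?thesis unfolding tp by (rule power_less_imp_less_base) simp
    qed
  qed
  with c t show ?thesis by (intro tangent_vector_normal_coneI)
qed

section \<open>Tangent vectors at the base point and the two implications\<close>

lemma geodesic_to_joins:
  fixes x y :: "'a::metric_space"
  assumes "uniquely_geodesic TYPE('a)"
  shows "joins (geodesic_to x y) x y"
proof -
  have "\<exists>g. joins g x y" using assms unfolding uniquely_geodesic_def geodesic_segment_def by blast
  then show ?thesis unfolding geodesic_to_def by (rule someI_ex)
qed

lemma joins_geodesics_at:
  assumes "joins h x y" "x \<noteq> y"
  shows "(h, dist x y) \<in> geodesics_at x"
  using assms unfolding joins_wrt_def geodesics_at_def by auto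

lemma geodesics_at_restrict:
  assumes "(g, l) \<in> geodesics_at x" "0 < m" "m \<le> l"
  shows "(g, m) \<in> geodesics_at x" "joins g x (g m)"
proof -
  show "(g, m) \<in> geodesics_at x"
    using assms unfolding geodesics_at_def geodesic_wrt_def by auto
  then show "joins g x (g m)"
    using geodesics_at_dist(2)[OF assms(1), of m m] assms(2,3)
    unfolding joins_wrt_def geodesics_at_def by auto
qed

text \<open>Extending a short initial piece of a representative to length \<open>R\<close> changes
  nothing near \<open>x\<close>, hence not the direction.\<close>

lemma direction_representative_of_length:
  assumes ext: "geodesic_extension_around x R" and \<xi>: "\<xi> \<in> directions x"
  obtains g where "(g, R) \<in> geodesics_at x" "\<xi> = direction_of x g R"
proof -
  have R: "R > 0" using ext unfolding geodesic_extension_around_def by simp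
  obtain g l where g: "(g, l) \<in> geodesics_at x" "\<xi> = direction_of x g l"
    using \<xi> unfolding directions_def quotient_def direction_of_def by auto
  \<comment> \<open>Half of the minimum, so that \<open>g u\<close> is at distance strictly less
    than \<open>R\<close> from \<open>x\<close>.\<close>
  define u where "u = min l R / 2"
  have u: "0 < u" "u < R" "u \<le> l" unfolding u_def using R geodesics_at_start(2)[OF g(1)] by auto
  have d: "dist x (g u) = u" using geodesics_at_dist(2)[OF g(1), of u u] u by simp
  have "x \<in> ball x R" "g u \<in> ball x R" "x \<noteq> g u" "dist x (g u) < R" "joins g x (g u)"
    using d u R geodesics_at_restrict(2)[OF g(1) u(1,3)] by auto
  then obtain k where k: "geodesic k R" "\<forall>t\<in>{0..dist x (g u)}. k t = g t"
    using ext unfolding geodesic_extension_around_def by blast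
  have "k 0 = x" using k(2) d u geodesics_at_start(1)[OF g(1)] by simp
  then have kx: "(k, R) \<in> geodesics_at x" using k(1) R unfolding geodesics_at_def by simp
  have "alexandrov_angle g k = 0"
    using k(2) d u by (intro alexandrov_angle_eq_0[OF g(1) kx u(1)]) auto
  then show thesis using that[OF kx] direction_of_eqI[OF g(1) kx] g(2) by simp
qed

lemma tangent_inner_tangent_to:
  fixes x y :: "'a::metric_space"
  assumes "uniquely_geodesic TYPE('a)" "x \<noteq> y" "(g, l) \<in> geodesics_at x"
  shows "tangent_inner (tangent_vector x g l r) (tangent_to x y) =
    r * dist x y * cos (alexandrov_angle g (geodesic_to x y))"
  unfolding tangent_to_def
  using assms joins_geodesics_at[OF geodesic_to_joins] by (intro tangent_inner_tangent_vector) auto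

lemma tangent_to_self: "tangent_to x x = Apex"
  unfolding tangent_to_def tangent_vector_def cone_point_def by simp

lemma tangent_inner_Apex_right: "tangent_inner v Apex = 0"
  by (cases v) auto

text \<open>The slope bound holds for each \<open>K\<close> below the cosine of the angle; letting
  \<open>K\<close> tend to it and clearing denominators yields the scalar product.\<close>

lemma subdifferential_imp_subgradient_inequality:
  fixes x :: "'a::metric_space"
  assumes ug: "uniquely_geodesic TYPE('a)" and conv: "geodesically_convex_fun f"
    and R: "0 < R" and inf: "\<And>y. f y \<noteq> -\<infinity>" and fx: "f x = ereal F"
    and v: "v \<in> subdifferential R f x"
  shows "ereal (tangent_inner v (tangent_to x y)) + f x \<le> f y"
proof (cases "x = y \<or> f y = \<infinity>")
  case True
  then show ?thesis
    by (auto simp: tangent_to_self tangent_inner_Apex_right simp flip: zero_ereal_def)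
next
  case False
  then obtain G where fy: "f y = ereal G" using inf[of y] by (cases "f y") auto
  have ne: "x \<noteq> y" using False by simp
  obtain g l r where v: "v = tangent_vector x g l r" and r: "0 \<le> r"
    and gr: "(g, l) \<in> geodesics_at x \<and> R \<le> l \<or> r = 0 \<and> g = (\<lambda>_. x)"
    and n: "tangent_vector (x, F) (descent_path f x g r) R 1 \<in> normal_cone (epigraph f) (x, F)"
    using v fx unfolding subdifferential_def by auto
  have c: "(descent_path f x g r, R) \<in> geodesics_at (x, F)"
  proof -
    have "r = 0 \<or> (\<forall>s\<in>{0..R}. \<forall>t\<in>{0..R}. dist (g s) (g t) = \<bar>s - t\<bar>)" "g 0 = x"
      using gr geodesics_at_dist(1)[of g l x] geodesics_at_start(1)[of g l x] by auto
    then show ?thesis using descent_path_geodesics_at[OF R r, of g x f] fx by simp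
  qed
  define h where "h = geodesic_to x y"
  have h: "joins h x y" unfolding h_def by (rule geodesic_to_joins[OF ug])
  note hx = joins_geodesics_at[OF h ne]
  note bound = normal_epigraph_slope_bound[OF conv h ne fx fy r c n]
  have u: "dist x y > 0" using ne by simp
  have "tangent_inner v (tangent_to x y) \<le> G - F"
  proof (cases "r = 0")
    case True
    have g0: "g 0 = x" using gr geodesics_at_start(1) by auto
    \<comment> \<open>For \<open>r = 0\<close> the path is vertical over \<open>x\<close>;
      \<open>K = 0\<close> serves, and the bound says \<open>F \<le> G\<close>.\<close>
    have "r * 0 \<le> (G - F) / dist x y"
    proof (rule bound[OF u])
      fix s t assume "0 < t" "t < dist x y"
      then show "(dist (g (r * s)) (h t))\<^sup>2 \<le> (r * s)\<^sup>2 + t\<^sup>2 - 2 * (r * s) * t * 0"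
        using True g0 geodesics_at_dist(2)[OF hx, of t t] by simp
    qed
    then have "0 \<le> G - F" using u by (simp add: zero_le_divide_iff)
    then show ?thesis unfolding v tangent_vector_def cone_point_def using True by simp
  next
    case False
    then have g: "(g, l) \<in> geodesics_at x" and rp: "r > 0" using gr r by auto
    have "cos (alexandrov_angle g h) \<le> (G - F) / dist x y / r"
    proof (rule dense_le)
      fix K assume K: "K < cos (alexandrov_angle g h)"
      obtain e where e: "0 < e"
        "\<And>s t. 0 < s \<Longrightarrow> s < e \<Longrightarrow> 0 < t \<Longrightarrow> t < e \<Longrightarrow> (dist (g s) (h t))\<^sup>2 \<le> s\<^sup>2 + t\<^sup>2 - 2 * s * t * K"
        using alexandrov_angle_hinge[OF g hx K] by blast
      have "r * K \<le> (G - F) / dist x y"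
      proof (rule bound)
        \<comment> \<open>The geodesic is evaluated at \<open>r * s\<close>, which
          \<open>s < e / r\<close> keeps below \<open>e\<close>.\<close>
        show "0 < min e (e / r)" using e(1) rp by simp
        fix s t assume st: "0 < s" "s < min e (e / r)" "0 < t" "t < min e (e / r)"
        then have "r * s < e" using rp by (simp add: pos_less_divide_eq mult.commute)
        then show "(dist (g (r * s)) (h t))\<^sup>2 \<le> (r * s)\<^sup>2 + t\<^sup>2 - 2 * (r * s) * t * K"
          using st rp by (intro e(2)) auto
      qed
      then show "K \<le> (G - F) / dist x y / r"
        by (subst pos_le_divide_eq[OF rp]) (simp add: mult.commute)
    qed
    then have "r * dist x y * cos (alexandrov_angle g h) \<le> G - F"
      unfolding pos_le_divide_eq[OF rp] pos_le_divide_eq[OF u] by (simp add: mult_ac)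
    then show ?thesis unfolding v tangent_inner_tangent_to[OF ug ne g] h_def .
  qed
  then show ?thesis unfolding fx fy by simp
qed

text \<open>A representative of length exactly \<open>R\<close>, or the constant path for the
  origin, makes \<open>normal_epigraphI\<close> applicable.\<close>

lemma subgradient_inequality_imp_subdifferential:
  fixes x :: "'a::metric_space"
  assumes k: "\<kappa> > 0" and CAT: "CAT TYPE('a) \<kappa>" and ug: "uniquely_geodesic TYPE('a)"
    and ext: "geodesic_extension_around x R" and fx: "f x = ereal F" and v: "v \<in> tangent_space x"
    and sub: "\<And>y. ereal (tangent_inner v (tangent_to x y)) + f x \<le> f y"
  shows "v \<in> subdifferential R f x"
proof -
  have R: "R > 0" using ext unfolding geodesic_extension_around_def by simp
  \<comment> \<open>Stated for heights \<open>\<mu>\<close> in the epigraph instead of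
    \<open>f y\<close>, so that infinite values need no separate case.\<close>
  have sub': "tangent_inner v (tangent_to x y) \<le> \<mu> - F" if "f y \<le> ereal \<mu>" for y \<mu>
    using order_trans[OF sub that] unfolding fx by simp
  note h = geodesic_to_joins[OF ug, of x]
  have "\<exists>g r. 0 \<le> r \<and> (r = 0 \<and> g = (\<lambda>_. x) \<or> (g, R) \<in> geodesics_at x) \<and> v = tangent_vector x g R r"
  proof (cases "v = Apex")
    case True
    then show ?thesis by (intro exI[of _ "\<lambda>_. x"] exI[of _ 0]) (simp add: tangent_vector_def cone_point_def)
  next
    case False
    then obtain \<xi> r where \<xi>: "\<xi> \<in> directions x" "0 \<le> r" "v = cone_point \<xi> r"
      using v unfolding tangent_space_def by auto
    then show ?thesis using direction_representative_of_length[OF ext \<xi>(1)]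
      unfolding tangent_vector_def by metis
  qed
  then obtain g r where r: "0 \<le> r" and g: "r = 0 \<and> g = (\<lambda>_. x) \<or> (g, R) \<in> geodesics_at x"
    and veq: "v = tangent_vector x g R r" by blast
  have "r * dist x y * cos (alexandrov_angle g (geodesic_to x y)) \<le> \<mu> - F"
    if "x \<noteq> y" "f y \<le> ereal \<mu>" for y \<mu>
    using sub'[OF that(2)] g tangent_inner_tangent_to[OF ug that(1), of g R r]
    unfolding veq by (auto simp: tangent_vector_def cone_point_def)
  then have "tangent_vector (x, F) (descent_path f x g r) R 1 \<in> normal_cone (epigraph f) (x, F)"
    using g by (intro normal_epigraphI[where f = f and h = "geodesic_to x", OF k CAT r _ R h fx]) auto
  then show ?thesis
    using r g unfolding subdifferential_def veq mem_Collect_eq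
    by (intro exI[of _ g] exI[of _ R] exI[of _ r]) (auto simp: fx)
qed

theorem proposition4p4:
  fixes \<kappa> :: real
    and R :: "'a::metric_space \<Rightarrow> real"
    and f :: "'a \<Rightarrow> ereal"
    and x :: 'a
    and v :: "'a tangent"
  assumes "\<kappa> > 0"
    and "locally compact (UNIV :: 'a set)"
    and "uniquely_geodesic TYPE('a)"
    and "CAT TYPE('a) \<kappa>"
    and "\<And>p. geodesic_extension_around p (R p)"
    and "\<And>p. R p < pi / (2 * sqrt \<kappa>)"
    and "\<And>y. f y \<noteq> -\<infinity>"
    and "geodesically_convex_fun f"
    and "x \<in> effective_domain f"
    and "v \<in> tangent_space x"
  shows "v \<in> subdifferential (R x) f x \<longleftrightarrow>
    (\<forall>y. ereal (tangent_inner v (tangent_to x y)) + f x \<le> f y)"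
proof -
  obtain F where fx: "f x = ereal F"
    using assms(7)[of x] assms(9) unfolding effective_domain_def by (cases "f x") auto
  have R: "0 < R x" using assms(5)[of x] unfolding geodesic_extension_around_def by simp
  show ?thesis
  proof (intro iffI allI)
    fix y assume "v \<in> subdifferential (R x) f x"
    then show "ereal (tangent_inner v (tangent_to x y)) + f x \<le> f y"
      using subdifferential_imp_subgradient_inequality assms(3,7,8) R fx by blast
  next
    assume "\<forall>y. ereal (tangent_inner v (tangent_to x y)) + f x \<le> f y"
    then show "v \<in> subdifferential (R x) f x"
      using subgradient_inequality_imp_subdifferential[where f = f and R = "R x", OF assms(1,4,3) assms(5)[of x] fx assms(10)] by blast
  qed
qed

end
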